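(* Let $\alpha\in(0,1)$, let $\phi_{\mathrm{Energy}}=\mathbf 1(U_{\mathrm{Energy}}>c_{\alpha,\mathrm{Eng}})$, where $c_{\alpha,\mathrm{Eng}}$ is the $\alpha$ level permutation critical value of $U_{\mathrm{Energy}}$, and for a sufficiently large constant $c>0$ let $\epsilon^\star_{m,n}=c\,(m^{-1/2}+n^{-1/2})$. Then there exists a pair of distributions belonging to $\mathcal F(\epsilon^\star_{m,n})$ such that the energy test becomes asymptotically powerless, i.e. $$\lim_{m,n\to\infty}\ \inf_{(P_X,P_Y)\in\mathcal F(\epsilon^\star_{m,n})}\mathbb{P}_1(\phi_{\mathrm{Energy}}=1)\le\alpha .$$
   Context: Data: $\mathcal X_m=\{X_1,\dots,X_m\}$ i.i.d. from $P_X$ and, independently, $\mathcal Y_n=\{Y_1,\dots,Y_n\}$ i.i.d. from $P_Y$ on $\mathbb{R}^d$, $m,n\ge2$, $N=m+n$. All pairs considered satisfy the standing assumption that $\beta^\top X$ and $\beta^\top Y$ ($X\sim P_X$, $Y\sim P_Y$) have continuous distribution functions for $\lambda$-almost all $\beta\in\mathbb{S}^{d-1}$, $\lambda$ being the uniform probability measure on the unit sphere. $\mathbb{P}_1$ is the probability when the data come from $(P_X,P_Y)$. CvM-distance: $W_d\ge0$ with $$W_d^2(P_X,P_Y)=\int_{\mathbb{S}^{d-1}}\int_{\mathbb{R}}\big(F_{\beta^\top X}(t)-F_{\beta^\top Y}(t)\big)^2\,d\{\vartheta_XF_{\beta^\top X}(t)+\vartheta_YF_{\beta^\top Y}(t)\}\,d\lambda(\beta),$$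 where $F_{\beta^\top X}$, $F_{\beta^\top Y}$ are the distribution functions of $\beta^\top X$, $\beta^\top Y$, $\vartheta_X\in(0,1)$ is a fixed value and $\vartheta_Y=1-\vartheta_X$ (under the continuity assumption the value of $W_d$ does not depend on $\vartheta_X$). $\mathcal F(\epsilon)=\{(P_X,P_Y):W_d(P_X,P_Y)\ge\epsilon\}$. Energy statistic: $$U_{\mathrm{Energy}}=\frac2{mn}\sum_{i=1}^m\sum_{j=1}^n\|X_i-Y_j\|-\frac1{m(m-1)}\sum_{i_1\ne i_2}\|X_{i_1}-X_{i_2}\|-\frac1{n(n-1)}\sum_{j_1\ne j_2}\|Y_{j_1}-Y_{j_2}\|.$$ Permutation critical value: with pooled sample $(Z_1,\dots,Z_N)=(X_1,\dots,X_m,Y_1,\dots,Y_n)$, $c_{\alpha,\mathrm{Eng}}=\inf\{t:1-\alpha\le\frac1{N!}\sum_{\varpi}\mathbf 1(U_{\mathrm{Energy}}(Z_\varpi)\le t)\}$, the sum over all permutations $\varpi$ of $\{1,\dots,N\}$, where $U_{\mathrm{Energy}}(Z_\varpi)$ is computed with first sample $Z_{\varpi(1)},\dots,Z_{\varpi(m)}$ and second sample $Z_{\varpi(m+1)},\dots,Z_{\varpi(N)}$. *)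

theory Defs
  imports "HOL-Probability.Probability" "HOL-Combinatorics.Permutations"
begin

text \<open>The uniform probability measure on the unit sphere, as the radial projection of the
  uniform distribution on the unit ball. It lives on the Borel sets of the whole space and
  gives mass one to the sphere.\<close>

definition uniform_sphere :: "'a::euclidean_space measure" where
  "uniform_sphere = distr (uniform_measure lborel (ball 0 1)) borel (\<lambda>x. x /\<^sub>R norm x)"

definition proj_cdf :: "'a::euclidean_space measure \<Rightarrow> 'a \<Rightarrow> real \<Rightarrow> real" where
  "proj_cdf P \<beta> = cdf (distr P borel (\<lambda>x. \<beta> \<bullet> x))"

text \<open>\<open>interval_measure F\<close> is the Lebesgue--Stieltjes measure \<open>dF\<close>.\<close>

definition cvm_dist :: "real \<Rightarrow> 'a::euclidean_space measure \<Rightarrow> 'a measure \<Rightarrow> real" where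
  "cvm_dist \<theta> PX PY = sqrt (\<integral>\<beta>.
     (\<integral>t. (proj_cdf PX \<beta> t - proj_cdf PY \<beta> t)\<^sup>2
        \<partial>interval_measure (\<lambda>t. \<theta> * proj_cdf PX \<beta> t + (1 - \<theta>) * proj_cdf PY \<beta> t))
     \<partial>uniform_sphere)"

definition admissible :: "'a::euclidean_space measure \<Rightarrow> 'a measure \<Rightarrow> bool" where
  "admissible PX PY \<longleftrightarrow>
     prob_space PX \<and> sets PX = sets borel \<and> prob_space PY \<and> sets PY = sets borel \<and>
     (AE \<beta> in uniform_sphere.
        continuous_on UNIV (proj_cdf PX \<beta>) \<and> continuous_on UNIV (proj_cdf PY \<beta>))"

definition cvm_class :: "real \<Rightarrow> real \<Rightarrow> ('a::euclidean_space measure \<times> 'a measure) set" where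
  "cvm_class \<theta> \<epsilon> = {(PX, PY). admissible PX PY \<and> cvm_dist \<theta> PX PY \<ge> \<epsilon>}"

text \<open>Samples are indexed from 0: the pooled sample is \<open>z 0, \<dots>, z (m + n - 1)\<close>, of which the
  first \<open>m\<close> entries form the first sample and the remaining \<open>n\<close> entries the second.\<close>

definition energy_stat :: "nat \<Rightarrow> nat \<Rightarrow> (nat \<Rightarrow> 'a::euclidean_space) \<Rightarrow> real" where
  "energy_stat m n z = (let x = z; y = (\<lambda>j. z (m + j)) in
     2 / (real m * real n) * (\<Sum>i<m. \<Sum>j<n. norm (x i - y j))
     - 1 / (real m * (real m - 1)) * (\<Sum>i<m. \<Sum>j\<in>{..<m} - {i}. norm (x i - x j))
     - 1 / (real n * (real n - 1)) * (\<Sum>i<n. \<Sum>j\<in>{..<n} - {i}. norm (y i - y j)))"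

definition energy_critical_value :: 
  "real \<Rightarrow> nat \<Rightarrow> nat \<Rightarrow> (nat \<Rightarrow> 'a::euclidean_space) \<Rightarrow> real" where
  "energy_critical_value \<alpha> m n z = Inf {t. 1 - \<alpha> \<le>
     1 / fact (m + n) *
       (\<Sum>p | p permutes {..<m + n}. of_bool (energy_stat m n (z \<circ> p) \<le> t))}"

definition energy_test :: "real \<Rightarrow> nat \<Rightarrow> nat \<Rightarrow> (nat \<Rightarrow> 'a::euclidean_space) \<Rightarrow> nat" where
  "energy_test \<alpha> m n z = of_bool (energy_stat m n z > energy_critical_value \<alpha> m n z)"

text \<open>The joint law of the pooled sample \<open>X\<^sub>1, \<dots>, X\<^sub>m, Y\<^sub>1, \<dots>, Y\<^sub>n\<close>.\<close>

definition two_sample :: 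
  "nat \<Rightarrow> nat \<Rightarrow> 'a measure \<Rightarrow> 'a measure \<Rightarrow> (nat \<Rightarrow> 'a) measure" where
  "two_sample m n PX PY = (\<Pi>\<^sub>M i\<in>{..<m + n}. if i < m then PX else PY)"

definition energy_power :: 
  "real \<Rightarrow> nat \<Rightarrow> nat \<Rightarrow> 'a::euclidean_space measure \<Rightarrow> 'a measure \<Rightarrow> real" where
  "energy_power \<alpha> m n PX PY =
     measure (two_sample m n PX PY)
       {z \<in> space (two_sample m n PX PY). energy_test \<alpha> m n z = 1}"


lemma prob_space_uniform_sphere: "prob_space (uniform_sphere :: 'a::euclidean_space measure)"
proof -
  have "prob_space (uniform_measure lborel (ball (0::'a) 1))"
    using emeasure_lborel_ball_finite[of "0::'a" 1] unit_ball_vol_pos[of "real DIM('a)"]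
    by (intro prob_space_uniform_measure) (auto simp: emeasure_ball simp del: unit_ball_vol_pos)
  then show ?thesis
    unfolding uniform_sphere_def by (rule prob_space.prob_space_distr) simp
qed

lemma AE_uniform_sphere: "AE \<beta> in uniform_sphere. \<beta> \<in> sphere (0::'a::euclidean_space) 1"
proof -
  have "AE x in lborel. x \<notin> {0::'a}"
    by (intro AE_not_in) (simp add: null_sets_def)
  then have "AE x in uniform_measure lborel (ball (0::'a) 1). x /\<^sub>R norm x \<in> sphere 0 1"
    by (intro AE_uniform_measureI) auto
  then show ?thesis
    unfolding uniform_sphere_def by (subst AE_distr_iff) auto
qed

text \<open>Rejection is a statement about finitely many comparisons of \<open>U\<close>-values, hence measurable.\<close>

lemma energy_test_reject_iff:
  assumes "\<alpha> \<in> {0<..<1}"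
  shows "energy_test \<alpha> m n z = 1 \<longleftrightarrow> 1 - \<alpha> \<le> 1 / fact (m + n) *
    (\<Sum>p | p permutes {..<m + n}. of_bool (energy_stat m n (z \<circ> p) < energy_stat m n z))"
proof -
  define P where "P = {p. p permutes {..<m + n}}"
  define u where "u p = energy_stat m n (z \<circ> p)" for p
  define G where "G t = 1 / fact (m + n) * (\<Sum>p\<in>P. of_bool (u p \<le> t) :: real)" for t :: real
  define s where "s = energy_stat m n z"
  have finP: "finite P" unfolding P_def by (simp add: finite_permutations)
  have cardP: "real (card P) = fact (m + n)"
    unfolding P_def by (subst card_permutations[of _ "m + n"]) auto
  have cmp: "1 / fact (m + n) * (\<Sum>p\<in>P. of_bool (A p)) \<le> 1 / fact (m + n) * (\<Sum>p\<in>P. of_bool (B p) :: real)"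
    if "\<And>p. p \<in> P \<Longrightarrow> A p \<Longrightarrow> B p" for A B
    using that by (intro mult_left_mono sum_mono) auto
  define S where "S = {t. 1 - \<alpha> \<le> G t}"
  have "Max (u ` P) \<in> S"
  proof -
    have "(\<Sum>p\<in>P. of_bool (u p \<le> Max (u ` P)) :: real) = (\<Sum>p\<in>P. 1)"
      using finP by (intro sum.cong) auto
    then show ?thesis
      using assms cardP by (simp add: S_def G_def del: of_bool_eq_1_iff)
  qed
  then have ne: "S \<noteq> {}" by auto
  have bdd: "bdd_below S"
  proof (rule bdd_belowI)
    fix t assume "t \<in> S"
    show "Min (u ` P) \<le> t"
    proof (rule ccontr)
      assume "\<not> ?thesis"
      then have "\<not> u p \<le> t" if "p \<in> P" for p
        using that finP by (meson Min_le finite_imageI imageI not_le order.strict_trans1 order_trans)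
      then have "G t = 0" by (simp add: G_def)
      with \<open>t \<in> S\<close> assms show False by (simp add: S_def)
    qed
  qed
  have "energy_test \<alpha> m n z = 1 \<longleftrightarrow> Inf S < s"
    by (simp add: energy_test_def energy_critical_value_def S_def G_def P_def u_def s_def)
  also have "\<dots> \<longleftrightarrow> (\<exists>t\<in>S. t < s)"
    using ne bdd by (simp add: cInf_less_iff)
  also have "\<dots> \<longleftrightarrow> 1 - \<alpha> \<le> 1 / fact (m + n) * (\<Sum>p\<in>P. of_bool (u p < s))" (is "_ \<longleftrightarrow> ?R")
  proof
    assume "\<exists>t\<in>S. t < s"
    then obtain t where t: "1 - \<alpha> \<le> G t" "t < s" by (auto simp: S_def)
    note t(1)
    also have "G t \<le> 1 / fact (m + n) * (\<Sum>p\<in>P. of_bool (u p < s))"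
      unfolding G_def using t(2) by (intro cmp) auto
    finally show ?R .
  next
    assume R: ?R
    define Q where "Q = {p\<in>P. u p < s}"
    have "Q \<noteq> {}"
    proof
      assume "Q = {}"
      then have "(\<Sum>p\<in>P. of_bool (u p < s)) = (0::real)"
        by (auto simp: Q_def intro!: sum.neutral)
      with R assms show False by simp
    qed
    define t where "t = Max (u ` Q)"
    have finQ: "finite Q" using finP by (simp add: Q_def)
    have "t \<in> u ` Q" unfolding t_def using finQ \<open>Q \<noteq> {}\<close> by (intro Max_in) auto
    then have "t < s" by (auto simp: Q_def)
    moreover have "?R \<longrightarrow> 1 - \<alpha> \<le> G t"
    proof
      assume ?R
      also have "1 / fact (m + n) * (\<Sum>p\<in>P. of_bool (u p < s)) \<le> G t"
        unfolding G_def using finQ by (intro cmp) (auto simp: t_def Q_def)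
      finally show "1 - \<alpha> \<le> G t" .
    qed
    ultimately show "\<exists>t\<in>S. t < s" using R by (auto simp: S_def)
  qed
  finally show ?thesis by (simp add: P_def u_def s_def)
qed

lemma energy_test_reject_sets:
  fixes PX PY :: "'a::euclidean_space measure"
  assumes "\<alpha> \<in> {0<..<1}" and [measurable_cong]: "sets PX = sets borel" "sets PY = sets borel"
  shows "{z \<in> space (two_sample m n PX PY). energy_test \<alpha> m n z = 1} \<in> sets (two_sample m n PX PY)"
proof -
  have comp: "(\<lambda>z. z i) \<in> borel_measurable (two_sample m n PX PY)" if "i < m + n" for i
  proof -
    have "(\<lambda>z. z i) \<in> measurable (two_sample m n PX PY) (if i < m then PX else PY)"
      unfolding two_sample_def using that by (intro measurable_component_singleton) auto
    also have "\<dots> = borel_measurable (two_sample m n PX PY)"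
      using assms by (intro measurable_cong_sets) auto
    finally show ?thesis .
  qed
  have stat: "(\<lambda>z. energy_stat m n (z \<circ> p)) \<in> borel_measurable (two_sample m n PX PY)"
    if p: "p permutes {..<m + n}" for p
  proof -
    have "p i < m + n" if "i < m + n" for i
      using permutes_in_image[OF p, of i] that by simp
    then have c: "(\<lambda>z. z (p i)) \<in> borel_measurable (two_sample m n PX PY)" if "i < m + n" for i
      using that comp by blast
    show ?thesis
      unfolding energy_stat_def Let_def o_def
      by (intro borel_measurable_diff borel_measurable_times borel_measurable_const 
            borel_measurable_sum measurable_compose[OF _ borel_measurable_norm] c) auto
  qed
  have [measurable]: "(\<lambda>z. energy_stat m n z) \<in> borel_measurable (two_sample m n PX PY)"
    using stat[OF permutes_id] by simp
  have "(\<lambda>z. of_bool (energy_stat m n (z \<circ> p) < energy_stat m n z) :: real) 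
      \<in> borel_measurable (two_sample m n PX PY)"
    if "p permutes {..<m + n}" for p
    using stat[OF that] by measurable
  then have "(\<lambda>z. 1 / fact (m + n) * (\<Sum>p | p permutes {..<m + n}. 
      of_bool (energy_stat m n (z \<circ> p) < energy_stat m n z)) :: real)
      \<in> borel_measurable (two_sample m n PX PY)"
    by (intro borel_measurable_times borel_measurable_const borel_measurable_sum) auto
  then show ?thesis
    unfolding energy_test_reject_iff[OF assms(1)] by measurable
qed

end

(* The alternatives are chosen as mixtures: PX is uniform on the union of the unit balls around 0
   and R e, and PY is its translate by 4 e. Directions close to e separate PX from PY near the
   origin, which keeps the CvM distance bounded below uniformly in R. The energy statistic, on the
   other hand, is R times the energy statistic of the labels "near 0" / "near R e" up to a bounded
   error, and the labels are i.i.d. fair bits under both PX and PY. For R large (depending on m and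
   n) the energy test is therefore a permutation test of exchangeable labels, whose level exceeds
   alpha at most by the probability of a tie. Given the total number of labels, the label statistic
   is a quadratic function of a hypergeometric variable, so ties become rare as m and n grow. *)

theory Submission
  imports Defs
begin

text \<open>The CvM distance compares distribution functions of projections and is blind to scale,
  while the energy statistic weighs every pair by its distance. Stretching a feature shared by both
  distributions thus keeps the former bounded below and lets the feature rule the latter. R is
  chosen after m and n, because the smallest nonzero difference of two label values may depend on
  them; the infimum is taken at each (m, n), so this is allowed. Weight 1/2 on each ball makes all
  2^(m+n) label patterns equally likely, so bounding the power becomes counting subsets of {..<m +
  n}. The delicate term is the ties: the bounded error may order tied values arbitrarily, so all of
  them count against the bound. A hypergeometric cell has at most 2^(m+n)/sqrt(mn) sets, but adding
  this up over all label totals leaves about (m+n)/sqrt(mn) >= 2 after normalisation. Hence it is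
  used only for totals within order sqrt(m+n) of the mean, and Chebyshev's inequality handles the
  others. The central part is then of order sqrt(1/m + 1/n), whatever the ratio of m and n.\<close>

section \<open>Stability of the energy statistic, and its values on labels\<close>

lemma energy_stat_perturb:
  fixes z :: "nat \<Rightarrow> 'a::euclidean_space" and v :: "nat \<Rightarrow> 'b::euclidean_space"
  assumes mn: "2 \<le> m" "2 \<le> n"
    and close: "\<And>i j. i < m + n \<Longrightarrow> j < m + n \<Longrightarrow> \<bar>norm (z i - z j) - R * norm (v i - v j)\<bar> \<le> C"
  shows "\<bar>energy_stat m n z - R * energy_stat m n v\<bar> \<le> 4 * C"
proof -
  define d where "d i j = norm (z i - z j) - R * norm (v i - v j)" for i j
  define a where "a = (\<Sum>i<m. \<Sum>j<n. d i (m + j))"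
  define b where "b = (\<Sum>i<m. \<Sum>j\<in>{..<m} - {i}. d i j)"
  define c where "c = (\<Sum>i<n. \<Sum>j\<in>{..<n} - {i}. d (m + i) (m + j))"
  have d: "\<bar>d i j\<bar> \<le> C" if "i < m + n" "j < m + n" for i j
    using close[OF that] by (simp add: d_def)
  have "\<bar>a\<bar> \<le> (\<Sum>i<m. \<Sum>j<n. C)"
    unfolding a_def by (rule order_trans[OF sum_abs] sum_mono)+ (auto intro!: d)
  then have a: "\<bar>a\<bar> \<le> real m * real n * C" by simp
  have "\<bar>b\<bar> \<le> (\<Sum>i<m. \<Sum>j\<in>{..<m} - {i}. C)"
    unfolding b_def by (rule order_trans[OF sum_abs] sum_mono)+ (auto intro!: d)
  then have b: "\<bar>b\<bar> \<le> real m * (real m - 1) * C" using mn by (simp add: of_nat_diff)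
  have "\<bar>c\<bar> \<le> (\<Sum>i<n. \<Sum>j\<in>{..<n} - {i}. C)"
    unfolding c_def by (rule order_trans[OF sum_abs] sum_mono)+ (auto intro!: d)
  then have c: "\<bar>c\<bar> \<le> real n * (real n - 1) * C" using mn by (simp add: of_nat_diff)
  have eq: "energy_stat m n z - R * energy_stat m n v
      = 2 / (real m * real n) * a - 1 / (real m * (real m - 1)) * b - 1 / (real n * (real n - 1)) * c"
    unfolding energy_stat_def Let_def a_def b_def c_def d_def sum_subtractf sum_distrib_left[symmetric]
    by (simp only: right_diff_distrib mult_ac)
  have pos: "0 < real m * real n" "0 < real m * (real m - 1)" "0 < real n * (real n - 1)"
    using mn by auto
  \<comment> \<open>\<open>q\<close> is the number of pairs in an average and \<open>r\<close> the
    weight of that average in U: 2 between the samples and 1 within each, whence the total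
    4.\<close>
  have bound: "\<bar>r / q * x\<bar> \<le> r * C" if "0 < q" "0 \<le> r" "\<bar>x\<bar> \<le> q * C" for r q x :: real
  proof -
    have "\<bar>r / q * x\<bar> = r / q * \<bar>x\<bar>" using that by (simp add: abs_mult)
    also have "\<dots> \<le> r / q * (q * C)" using that by (intro mult_left_mono) auto
    finally show ?thesis using that by simp
  qed
  have "\<bar>2 / (real m * real n) * a\<bar> \<le> 2 * C" using bound[OF pos(1) _ a, of 2] by simp
  moreover have "\<bar>1 / (real m * (real m - 1)) * b\<bar> \<le> 1 * C" using bound[OF pos(2) _ b, of 1] by simp
  moreover have "\<bar>1 / (real n * (real n - 1)) * c\<bar> \<le> 1 * C" using bound[OF pos(3) _ c, of 1] by simp
  ultimately show ?thesis unfolding eq by linarith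
qed

text \<open>Encoding the bits by the set \<open>B\<close> of indices labelled 1 turns permuting the
  sample into taking a preimage of \<open>B\<close>, and conditioning on the number of labels into
  fixing \<open>card B\<close>.\<close>

definition label_stat :: "nat \<Rightarrow> nat \<Rightarrow> nat set \<Rightarrow> real" where
  "label_stat m n B = energy_stat m n (\<lambda>i. of_bool (i \<in> B) :: real)"

lemma label_stat_eq:
  fixes B :: "nat set"
  assumes mn: "2 \<le> m" "2 \<le> n"
  defines "k \<equiv> real (card (B \<inter> {..<m}))" and "l \<equiv> real (card (B \<inter> {m..<m + n}))"
  shows "label_stat m n B = 2 / (real m * real n) * (real n * k + real m * l - 2 * k * l)
     - 1 / (real m * (real m - 1)) * (2 * real m * k - 2 * k\<^sup>2)
     - 1 / (real n * (real n - 1)) * (2 * real n * l - 2 * l\<^sup>2)"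
proof -
  define v :: "nat \<Rightarrow> real" where "v i = of_bool (i \<in> B)" for i
  have sx: "(\<Sum>i<m. v i) = k"
    unfolding v_def k_def by (simp add: of_bool_def sum.If_cases Int_commute)
  have sy: "(\<Sum>j<n. v (m + j)) = l"
  proof -
    have "(\<Sum>j<n. v (m + j)) = (\<Sum>i\<in>{m..<m + n}. v i)"
      by (rule sum.reindex_bij_witness[where i="\<lambda>i. i - m" and j="\<lambda>j. m + j"]) auto
    also have "\<dots> = real (card ({m..<m + n} \<inter> {i. i \<in> B}))"
      unfolding v_def by (simp add: of_bool_def sum.If_cases)
    finally show ?thesis by (simp add: l_def Int_commute)
  qed
  \<comment> \<open>On bits the absolute difference is a polynomial, so the double sums reduce to
    the label counts \<open>k\<close> and \<open>l\<close> of the two samples.\<close>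
  have norm: "norm (v i - v j) = v i + v j - 2 * (v i * v j)" for i j
    by (simp add: v_def of_bool_def)
  have xy: "(\<Sum>i<m. \<Sum>j<n. norm (v i - v (m + j))) = real n * k + real m * l - 2 * k * l"
  proof -
    have "(\<Sum>i<m. \<Sum>j<n. norm (v i - v (m + j))) = (\<Sum>i<m. real n * v i + l - 2 * (v i * l))"
      unfolding norm by (simp add: sum.distrib sum_subtractf sy flip: sum_distrib_left)
    also have "\<dots> = real n * k + real m * l - 2 * (k * l)"
      by (simp add: sum.distrib sum_subtractf sx flip: sum_distrib_left sum_distrib_right)
    finally show ?thesis by simp
  qed
  have xx: "(\<Sum>i<p. \<Sum>j\<in>{..<p} - {i}. norm (w i - w j)) = 2 * real p * s - 2 * s\<^sup>2"
    if s: "(\<Sum>i<p. w i) = s" and w: "\<And>i j. norm (w i - w j) = w i + w j - 2 * (w i * w j)"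
    for p s and w :: "nat \<Rightarrow> real"
  proof -
    have "(\<Sum>i<p. \<Sum>j\<in>{..<p} - {i}. norm (w i - w j)) = (\<Sum>i<p. \<Sum>j<p. norm (w i - w j))"
      by (intro sum.cong refl sum.mono_neutral_left) auto
    also have "\<dots> = 2 * real p * s - 2 * s\<^sup>2"
    proof -
      have "(\<Sum>i<p. \<Sum>j<p. norm (w i - w j)) = (\<Sum>i<p. real p * w i + s - 2 * (w i * s))"
        unfolding w by (simp add: sum.distrib sum_subtractf s flip: sum_distrib_left)
      also have "\<dots> = real p * s + real p * s - 2 * (s * s)"
        by (simp add: sum.distrib sum_subtractf s flip: sum_distrib_left sum_distrib_right)
      finally show ?thesis by (simp add: power2_eq_square)
    qed
    finally show ?thesis .
  qed
  show ?thesis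
    unfolding label_stat_def v_def[symmetric] energy_stat_def Let_def xy xx[OF sx norm] xx[OF sy norm] ..
qed

section \<open>Ties of the label statistic among label sets of equal size\<close>

text \<open>Subtracting the equations of two distinct solutions k and l gives a(k + l) + b = 0,
  which determines l from k.\<close>

lemma card_quadratic_fibre_le_2:
  fixes a b c x :: real
  assumes "a \<noteq> 0"
  shows "finite {k :: nat. a * (real k)\<^sup>2 + b * real k + c = x}" (is "finite ?S")
    and "card {k :: nat. a * (real k)\<^sup>2 + b * real k + c = x} \<le> 2"
proof -
  have "\<exists>r s. ?S \<subseteq> {r, s}"
  proof (rule ccontr)
    assume no: "\<not> ?thesis"
    then obtain k where k: "k \<in> ?S" by blast
    with no obtain l where l: "l \<in> ?S" "l \<noteq> k" by blast
    with no obtain r where r: "r \<in> ?S" "r \<noteq> k" "r \<noteq> l" by blast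
    have root_sum: "a * (real k + real i) + b = 0" if "i \<in> ?S" "i \<noteq> k" for i
    proof -
      have "(real i - real k) * (a * (real k + real i) + b) = 0"
        using that k by (simp add: algebra_simps power2_eq_square)
      then show ?thesis using that by simp
    qed
    have "a * real l = a * real r"
      using root_sum[OF l] root_sum[OF r(1,2)] unfolding distrib_left by linarith
    then show False using assms r(3) by simp
  qed
  then obtain r s where rs: "?S \<subseteq> {r, s}" by blast
  show "finite ?S" by (rule finite_subset[OF rs]) simp
  have "card ?S \<le> card {r, s}" by (rule card_mono[OF _ rs]) simp
  also have "\<dots> \<le> 2" by (simp add: card_insert_if)
  finally show "card ?S \<le> 2" .
qed

abbreviation label_sets :: "nat \<Rightarrow> nat \<Rightarrow> nat \<Rightarrow> nat set set" where
  "label_sets m n K \<equiv> {B. B \<subseteq> {..<m + n} \<and> card B = K}"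

lemma card_label_sets_split:
  "card {B. B \<subseteq> {..<m + n} \<and> card B = K \<and> card (B \<inter> {..<m}) = k}
     \<le> (m choose k) * (n choose (K - k))"
proof -
  let ?L = "{B. B \<subseteq> {..<m + n} \<and> card B = K \<and> card (B \<inter> {..<m}) = k}"
  let ?f = "\<lambda>B. (B \<inter> {..<m}, B \<inter> {m..<m + n})"
  let ?R = "{A. A \<subseteq> {..<m} \<and> card A = k} \<times> {A. A \<subseteq> {m..<m + n} \<and> card A = K - k}"
  have split: "B = (B \<inter> {..<m}) \<union> (B \<inter> {m..<m + n})" if "B \<subseteq> {..<m + n}" for B
    using that by force
  have "inj_on ?f ?L"
  proof (rule inj_onI)
    fix A B assume "A \<in> ?L" "B \<in> ?L" and eq: "?f A = ?f B"
    then have AB: "A \<subseteq> {..<m + n}" "B \<subseteq> {..<m + n}" by auto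
    have "A = (A \<inter> {..<m}) \<union> (A \<inter> {m..<m + n})" by (rule split[OF AB(1)])
    also have "\<dots> = (B \<inter> {..<m}) \<union> (B \<inter> {m..<m + n})" using eq by simp
    also have "\<dots> = B" by (rule split[OF AB(2), symmetric])
    finally show "A = B" .
  qed
  moreover have "?f ` ?L \<subseteq> ?R"
  proof clarsimp
    fix B assume B: "B \<subseteq> {..<m + n}"
    have "card B = card (B \<inter> {..<m}) + card (B \<inter> {m..<m + n})"
      by (subst split[OF B], subst card_Un_disjoint) auto
    then show "card (B \<inter> {m..<m + n}) = card B - card (B \<inter> {..<m})" by simp
  qed
  moreover have "finite ?R" by simp
  ultimately have "card ?L \<le> card ?R"
    by (rule card_inj_on_le)
  also have "\<dots> = (m choose k) * (n choose (K - k))"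
    by (simp add: card_cartesian_product n_subsets)
  finally show ?thesis .
qed

text \<open>Substituting l = K - k makes the label statistic a quadratic in the number k of labels
  in the first sample. All three averages contribute positively to its leading coefficient, so a
  value is taken for at most two k, each a cell of at most \<open>M\<close> sets.\<close>

lemma card_label_stat_tie_le:
  assumes mn: "2 \<le> m" "2 \<le> n"
    and M: "\<And>k. k \<le> K \<Longrightarrow> real ((m choose k) * (n choose (K - k))) \<le> M"
  shows "real (card {B \<in> label_sets m n K. label_stat m n B = x}) \<le> 2 * M"
proof -
  have "0 \<le> M" using M[of 0] by (meson le0 of_nat_0_le_iff order_trans)
  define P where "P = 2 / (real m * real n)"
  define Q where "Q = 1 / (real m * (real m - 1))"
  define W where "W = 1 / (real n * (real n - 1))"
  have "0 < P" "0 < Q" "0 < W"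
    using mn by (auto simp: P_def Q_def W_def)
  define a where "a = 2 * P + 2 * Q + 2 * W"
  have "a \<noteq> 0" using \<open>0 < P\<close> \<open>0 < Q\<close> \<open>0 < W\<close> by (simp add: a_def)
  define b where "b = P * (real n - real m - 2 * real K) - 2 * real m * Q + W * (2 * real n - 4 * real K)"
  define c where "c = P * (real m * real K) - W * (2 * real n * real K - 2 * (real K)\<^sup>2)"
  have stat: "label_stat m n B = a * (real (card (B \<inter> {..<m})))\<^sup>2 + b * real (card (B \<inter> {..<m})) + c"
    if "B \<in> label_sets m n K" for B
  proof -
    define k where "k = real (card (B \<inter> {..<m}))"
    have "B = (B \<inter> {..<m}) \<union> (B \<inter> {m..<m + n})" using that by force
    moreover have "card ((B \<inter> {..<m}) \<union> (B \<inter> {m..<m + n})) = card (B \<inter> {..<m}) + card (B \<inter> {m..<m + n})"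
      by (rule card_Un_disjoint) auto
    ultimately have "card B = card (B \<inter> {..<m}) + card (B \<inter> {m..<m + n})" by simp
    then have l: "real (card (B \<inter> {m..<m + n})) = real K - k" using that by (simp add: k_def)
    have "label_stat m n B = a * k\<^sup>2 + b * k + c"
      unfolding label_stat_eq[OF mn] l k_def[symmetric] a_def b_def c_def
        P_def[symmetric] Q_def[symmetric] W_def[symmetric]
      by (simp add: algebra_simps power2_eq_square)
    then show ?thesis by (simp add: k_def)
  qed
  define S where "S = {k :: nat. a * (real k)\<^sup>2 + b * real k + c = x}"
  note S = card_quadratic_fibre_le_2[OF \<open>a \<noteq> 0\<close>, of b c x, folded S_def]
  let ?F = "\<lambda>k. {B. B \<subseteq> {..<m + n} \<and> card B = K \<and> card (B \<inter> {..<m}) = k}"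
  have fin: "finite (?F k)" for k by (rule finite_subset[of _ "Pow {..<m + n}"]) auto
  have "{B \<in> label_sets m n K. label_stat m n B = x} \<subseteq> (\<Union>k\<in>S. ?F k)"
    using stat by (auto simp: S_def)
  then have "card {B \<in> label_sets m n K. label_stat m n B = x} \<le> card (\<Union>k\<in>S. ?F k)"
    using S(1) fin by (intro card_mono finite_UN_I) auto
  also have "\<dots> \<le> (\<Sum>k\<in>S. card (?F k))" using S(1) by (rule card_UN_le)
  finally have "real (card {B \<in> label_sets m n K. label_stat m n B = x}) \<le> (\<Sum>k\<in>S. real (card (?F k)))"
    unfolding of_nat_sum[symmetric] of_nat_le_iff .
  also have "\<dots> \<le> (\<Sum>k\<in>S. M)"
  proof (rule sum_mono)
    fix k
    show "real (card (?F k)) \<le> M"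
    proof (cases "k \<le> K")
      case True
      show ?thesis by (rule order_trans[OF of_nat_mono[OF card_label_sets_split] M[OF True]])
    next
      case False
      \<comment> \<open>For k > K the difference \<open>K - k\<close> truncates to 0 and
        \<open>M\<close> bounds nothing, but such a cell is empty.\<close>
      have "card (B \<inter> {..<m}) \<le> card B" if "B \<subseteq> {..<m + n}" for B
        using finite_subset[OF that] by (intro card_mono) auto
      then have "?F k = {}" using False by fastforce
      then show ?thesis using \<open>0 \<le> M\<close> by (simp only: card.empty)
    qed
  qed
  also have "\<dots> \<le> 2 * M"
    using S(2) \<open>0 \<le> M\<close> by (simp add: mult_right_mono)
  finally show ?thesis .
qed

section \<open>The symmetric group acting on label sets\<close>

lemma exists_permutes_vimage_eq:
  assumes fin: "finite S" and sub: "B \<subseteq> S" "B' \<subseteq> S" and card: "card B = card B'"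
  shows "\<exists>q. q permutes S \<and> q -` B = B'"
proof -
  have finB: "finite B" "finite B'" using fin sub by (auto intro: finite_subset)
  obtain f where f: "bij_betw f B' B"
    using finite_same_card_bij[OF finB(2,1)] card by auto
  have "card (S - B') = card (S - B)" using fin sub card finB by (simp add: card_Diff_subset)
  then obtain g where g: "bij_betw g (S - B') (S - B)"
    using finite_same_card_bij[of "S - B'" "S - B"] fin by auto
  define q where "q x = (if x \<in> B' then f x else if x \<in> S then g x else x)" for x
  have qf: "bij_betw q B' B" using f by (subst bij_betw_cong[where g=f]) (auto simp: q_def)
  have qg: "bij_betw q (S - B') (S - B)" using g by (subst bij_betw_cong[where g=g]) (auto simp: q_def)
  have "bij_betw q (B' \<union> (S - B')) (B \<union> (S - B))"
    using qf qg by (rule bij_betw_combine) auto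
  then have "bij_betw q S S" using sub by (simp add: Un_absorb1)
  moreover have "q x = x" if "x \<notin> S" for x using that sub by (auto simp: q_def)
  ultimately have "q permutes S" by (rule bij_imp_permutes)
  moreover have "q -` B = B'"
  proof (intro set_eqI iffI)
    fix x assume "x \<in> q -` B"
    then have qx: "q x \<in> B" by simp
    show "x \<in> B'"
    proof (rule ccontr)
      assume "x \<notin> B'"
      then have "q x \<notin> B"
        using bij_betwE[OF qg] sub by (cases "x \<in> S") (auto simp: q_def)
      with qx show False by simp
    qed
  next
    fix x assume "x \<in> B'"
    then show "x \<in> q -` B" using bij_betwE[OF qf] by simp
  qed
  ultimately show ?thesis by blast
qed

lemma permutes_vimage_subset_card:
  assumes "p permutes S" "B \<subseteq> S"
  shows "p -` B \<subseteq> S" "card (p -` B) = card B"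
proof -
  show "p -` B \<subseteq> S" using permutes_in_image[OF assms(1)] assms(2) by auto
  show "card (p -` B) = card B"
    by (rule card_vimage_inj) (use permutes_inj[OF assms(1)] permutes_surj[OF assms(1)] in auto)
qed

text \<open>The symmetric group carries the uniform distribution on permutations to the uniform
  distribution on subsets of fixed size, by transitivity and double counting.\<close>

lemma card_permutes_vimage:
  assumes fin: "finite S" and B: "B \<subseteq> S" "card B = K"
  shows "card {A. A \<subseteq> S \<and> card A = K} * card {p. p permutes S \<and> Q (p -` B)}
     = card {p. p permutes S} * card {A. A \<subseteq> S \<and> card A = K \<and> Q A}"
proof -
  let ?P = "{p. p permutes S}" and ?L = "{A. A \<subseteq> S \<and> card A = K}"
  define c where "c A = (\<Sum>p\<in>?P. of_bool (Q (p -` A)) :: nat)" for A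
  have finP: "finite ?P" by (rule finite_permutations[OF fin])
  have finL: "finite ?L" using fin by simp
  have c_card: "c A = card {p. p permutes S \<and> Q (p -` A)}" for A
  proof -
    have "c A = card (?P \<inter> {p. Q (p -` A)})" unfolding c_def using finP by (simp add: of_bool_def sum.If_cases)
    also have "?P \<inter> {p. Q (p -` A)} = {p. p permutes S \<and> Q (p -` A)}" by auto
    finally show ?thesis .
  qed
  have const: "c A = c B" if "A \<in> ?L" for A
  proof -
    have "\<exists>q. q permutes S \<and> q -` B = A"
      using that B by (intro exists_permutes_vimage_eq[OF fin]) auto
    then obtain q where q: "q permutes S" "q -` B = A" by blast
    have "c B = (\<Sum>p\<in>?P. of_bool (Q ((q \<circ> p) -` B)))"
      unfolding c_def by (rule setum_permutations_compose_left[OF q(1)])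
    also have "\<dots> = c A" by (simp add: c_def vimage_comp[symmetric] q(2))
    finally show ?thesis by simp
  qed
  have inner: "(\<Sum>A\<in>?L. of_bool (Q (p -` A))) = card {A. A \<subseteq> S \<and> card A = K \<and> Q A}"
    if p: "p permutes S" for p
  proof -
    have "(\<Sum>A\<in>?L. of_bool (Q (p -` A))) = (\<Sum>A\<in>?L. of_bool (Q A) :: nat)"
    proof (rule sum.reindex_bij_witness[where i="\<lambda>A. inv p -` A" and j="\<lambda>A. p -` A"])
      have pi: "p \<circ> inv p = id" "inv p \<circ> p = id" using permutes_inv_o[OF p] by auto
      show "inv p -` (p -` A) = A" for A by (simp add: vimage_comp pi)
      show "p -` (inv p -` A) = A" for A by (simp add: vimage_comp pi)
      show "p -` A \<in> ?L" if "A \<in> ?L" for A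
        using permutes_vimage_subset_card[OF p] that by auto
      show "inv p -` A \<in> ?L" if "A \<in> ?L" for A
        using permutes_vimage_subset_card[OF permutes_inv[OF p]] that by auto
    qed auto
    also have "\<dots> = card (?L \<inter> {A. Q A})" using finL by (simp add: of_bool_def sum.If_cases)
    also have "?L \<inter> {A. Q A} = {A. A \<subseteq> S \<and> card A = K \<and> Q A}" by auto
    finally show ?thesis .
  qed
  have "card ?L * c B = (\<Sum>A\<in>?L. c A)" using const by simp
  also have "\<dots> = (\<Sum>p\<in>?P. \<Sum>A\<in>?L. of_bool (Q (p -` A)))" unfolding c_def by (rule sum.swap)
  also have "\<dots> = card ?P * card {A. A \<subseteq> S \<and> card A = K \<and> Q A}" using inner by simp
  finally show ?thesis by (simp add: c_card)
qed

section \<open>Level of the permutation test on labels\<close>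

text \<open>Let x be the least value of \<open>u\<close> on the set being counted. At most a
  fraction \<alpha> of \<open>L\<close> lies strictly above x, and what remains of the set lies in
  the single tie at x.\<close>

lemma card_upper_rank_le:
  fixes u :: "'b \<Rightarrow> real" and \<alpha> :: real
  assumes fin: "finite L" and \<alpha>: "0 \<le> \<alpha>"
    and tie: "\<And>x. real (card {p \<in> L. u p = x}) \<le> M"
  shows "real (card {s \<in> L. (1 - \<alpha>) * card L \<le> card {p \<in> L. u p \<le> u s}}) \<le> \<alpha> * card L + M"
proof (cases "{s \<in> L. (1 - \<alpha>) * card L \<le> card {p \<in> L. u p \<le> u s}} = {}")
  case True
  have "0 \<le> M" using tie[of 0] by linarith
  then show ?thesis unfolding True using \<alpha> by simp
next
  case False
  let ?S = "{s \<in> L. (1 - \<alpha>) * card L \<le> card {p \<in> L. u p \<le> u s}}"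
  have finS: "finite ?S" using fin by simp
  define x where "x = Min (u ` ?S)"
  have "x \<in> u ` ?S" unfolding x_def using finS False by (intro Min_in) auto
  then obtain s where s: "s \<in> ?S" "u s = x" by auto
  have "?S \<subseteq> {p \<in> L. u p > x} \<union> {p \<in> L. u p = x}"
  proof
    fix p assume p: "p \<in> ?S"
    then have "x \<le> u p" unfolding x_def using finS by (intro Min_le) auto
    then show "p \<in> {p \<in> L. u p > x} \<union> {p \<in> L. u p = x}" using p by auto
  qed
  then have "card ?S \<le> card ({p \<in> L. u p > x} \<union> {p \<in> L. u p = x})"
    using fin by (intro card_mono) auto
  also have "\<dots> \<le> card {p \<in> L. u p > x} + card {p \<in> L. u p = x}" by (rule card_Un_le)
  finally have "card ?S \<le> card {p \<in> L. u p > x} + card {p \<in> L. u p = x}" .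
  then have 1: "real (card ?S) \<le> real (card {p \<in> L. u p > x}) + M" using tie[of x] by linarith
  have "card L = card ({p \<in> L. u p > x} \<union> {p \<in> L. u p \<le> x})" by (rule arg_cong[where f=card]) auto
  also have "\<dots> = card {p \<in> L. u p > x} + card {p \<in> L. u p \<le> x}" using fin by (intro card_Un_disjoint) auto
  finally have "real (card L) = real (card {p \<in> L. u p > x}) + real (card {p \<in> L. u p \<le> x})" by simp
  moreover have "(1 - \<alpha>) * card L \<le> card {p \<in> L. u p \<le> x}" using s by simp
  ultimately have "real (card {p \<in> L. u p > x}) \<le> \<alpha> * card L" by (simp add: algebra_simps)
  with 1 show ?thesis by linarith
qed

text \<open>The comparison is weak although the energy test counts strictly smaller values: the
  approximation error can turn a tie of labels into a strict inequality either way, so this set must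
  contain every pattern that might lead to rejection.\<close>

definition label_reject :: "real \<Rightarrow> nat \<Rightarrow> nat \<Rightarrow> nat set set" where
  "label_reject \<alpha> m n = {B. B \<subseteq> {..<m + n} \<and> (1 - \<alpha>) * fact (m + n)
     \<le> card {p. p permutes {..<m + n} \<and> label_stat m n (p -` B) \<le> label_stat m n B}}"

text \<open>Within the layer of sets of size K, a random permutation of \<open>B\<close> is a
  uniform element of the layer, so rejection is a rank condition inside it. The bound
  \<open>M\<close> may vary with K, so that central and outlying layers can be treated differently;
  the layer sizes add up to 2^(m+n).\<close>

lemma card_label_reject_le:
  assumes mn: "2 \<le> m" "2 \<le> n" and \<alpha>: "0 \<le> \<alpha>"
    and M: "\<And>K k. K \<le> m + n \<Longrightarrow> k \<le> K \<Longrightarrow> real ((m choose k) * (n choose (K - k))) \<le> M K"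
  shows "real (card (label_reject \<alpha> m n)) \<le> \<alpha> * 2 ^ (m + n) + 2 * (\<Sum>K\<le>m + n. M K)"
proof -
  let ?L = "label_sets m n"
  have finL: "finite (?L K)" for K by simp
  have cardL: "card (?L K) = (m + n) choose K" for K by (simp add: n_subsets)
  have sub: "label_reject \<alpha> m n \<subseteq> (\<Union>K\<in>{..m + n}. label_reject \<alpha> m n \<inter> ?L K)"
  proof
    fix B assume B: "B \<in> label_reject \<alpha> m n"
    then have "B \<subseteq> {..<m + n}" by (simp add: label_reject_def)
    then have "card B \<le> m + n" using card_mono[of "{..<m + n}" B] by simp
    with B \<open>B \<subseteq> _\<close> show "B \<in> (\<Union>K\<in>{..m + n}. label_reject \<alpha> m n \<inter> ?L K)" by simp
  qed
  have layer: "real (card (label_reject \<alpha> m n \<inter> ?L K)) \<le> \<alpha> * ((m + n) choose K) + 2 * M K"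
    if K: "K \<le> m + n" for K
  proof -
    have "label_reject \<alpha> m n \<inter> ?L K
        \<subseteq> {B \<in> ?L K. (1 - \<alpha>) * card (?L K) \<le> card {A \<in> ?L K. label_stat m n A \<le> label_stat m n B}}"
    proof
      fix B assume "B \<in> label_reject \<alpha> m n \<inter> ?L K"
      then have B: "B \<subseteq> {..<m + n}" "card B = K"
        and rej: "(1 - \<alpha>) * fact (m + n)
          \<le> card {p. p permutes {..<m + n} \<and> label_stat m n (p -` B) \<le> label_stat m n B}" (is "_ \<le> real ?c")
        by (auto simp: label_reject_def)
      let ?a = "card {A \<in> ?L K. label_stat m n A \<le> label_stat m n B}"
      have all: "card {p. p permutes {..<m + n}} = fact (m + n)"
        by (rule card_permutations) auto
      have members: "{A \<in> ?L K. label_stat m n A \<le> label_stat m n B}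
          = {A. A \<subseteq> {..<m + n} \<and> card A = K \<and> label_stat m n A \<le> label_stat m n B}" by auto
      have "card (?L K) * ?c = card {p. p permutes {..<m + n}} * ?a"
        unfolding members by (rule card_permutes_vimage[OF finite_lessThan B])
      then have "real (card (?L K) * ?c) = real (fact (m + n) * ?a)"
        unfolding all by (rule arg_cong)
      then have "real (card (?L K)) * real ?c = fact (m + n) * real ?a"
        by (simp only: of_nat_mult of_nat_fact)
      moreover have "real (card (?L K)) * ((1 - \<alpha>) * fact (m + n)) \<le> real (card (?L K)) * real ?c"
        using rej by (rule mult_left_mono) simp
      ultimately have "fact (m + n) * ((1 - \<alpha>) * real (card (?L K))) \<le> fact (m + n) * real ?a"
        by (simp only: mult_ac)
      then have "(1 - \<alpha>) * real (card (?L K)) \<le> real ?a" by (subst (asm) mult_le_cancel_left_pos) auto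
      then show "B \<in> {B \<in> ?L K. (1 - \<alpha>) * card (?L K) \<le> card {A \<in> ?L K. label_stat m n A \<le> label_stat m n B}}"
        using B by simp
    qed
    then have "real (card (label_reject \<alpha> m n \<inter> ?L K)) \<le> real (card {B \<in> ?L K. (1 - \<alpha>) * card (?L K)
        \<le> card {A \<in> ?L K. label_stat m n A \<le> label_stat m n B}})"
      by (intro of_nat_mono card_mono) auto
    also have "\<dots> \<le> \<alpha> * card (?L K) + 2 * M K"
      by (rule card_upper_rank_le[OF finL \<alpha>], rule card_label_stat_tie_le[OF mn M[OF K]])
    finally show ?thesis by (simp only: cardL)
  qed
  have "card (label_reject \<alpha> m n) \<le> card (\<Union>K\<in>{..m + n}. label_reject \<alpha> m n \<inter> ?L K)"
    by (rule card_mono[OF _ sub]) auto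
  also have "\<dots> \<le> (\<Sum>K\<le>m + n. card (label_reject \<alpha> m n \<inter> ?L K))" by (rule card_UN_le) simp
  finally have "real (card (label_reject \<alpha> m n)) \<le> (\<Sum>K\<le>m + n. real (card (label_reject \<alpha> m n \<inter> ?L K)))"
    unfolding of_nat_sum[symmetric] of_nat_le_iff .
  also have "\<dots> \<le> (\<Sum>K\<le>m + n. \<alpha> * ((m + n) choose K) + 2 * M K)"
    by (intro sum_mono layer) simp
  also have "\<dots> = \<alpha> * real (\<Sum>K\<le>m + n. (m + n) choose K) + 2 * (\<Sum>K\<le>m + n. M K)"
    by (simp add: sum.distrib sum_distrib_left)
  also have "\<dots> = \<alpha> * 2 ^ (m + n) + 2 * (\<Sum>K\<le>m + n. M K)" by (simp add: choose_row_sum)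
  finally show ?thesis .
qed

section \<open>Binomial coefficients: maximum and second moment\<close>

text \<open>Passing from s to s + 1 multiplies the left side by 2 sqrt((2s+1)(2s+3))/(s+1), which is
  at most 4 because (2s+1)(2s+3) <= (2s+2)^2.\<close>

lemma central_binomial_upper_bound:
  "real ((2 * s) choose s) * sqrt (2 * real s + 1) \<le> 4 ^ s"
proof (induction s)
  case 0
  then show ?case by simp
next
  case (Suc s)
  define c where "c = real ((2 * s) choose s)"
  have "Suc s * (2 * Suc s choose Suc s) = (2 * Suc s) * (Suc (2 * s) choose s)"
    using Suc_times_binomial[of s "Suc (2 * s)"] by simp
  also have "(Suc (2 * s) choose s) = (Suc (2 * s) choose Suc s)"
    using binomial_symmetric[of s "Suc (2 * s)"] by (simp add: Suc_diff_le)
  also have "(2 * Suc s) * (Suc (2 * s) choose Suc s) = 2 * (Suc s * (Suc (2 * s) choose Suc s))"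
    by (simp only: mult_ac)
  also have "Suc s * (Suc (2 * s) choose Suc s) = Suc (2 * s) * (2 * s choose s)"
    by (rule Suc_times_binomial)
  finally have "real (Suc s * (2 * Suc s choose Suc s)) = real (2 * (Suc (2 * s) * (2 * s choose s)))"
    by (rule arg_cong)
  then have rec: "(real s + 1) * real (2 * Suc s choose Suc s) = 2 * (2 * real s + 1) * c"
    unfolding c_def of_nat_mult of_nat_Suc by (simp add: algebra_simps del: binomial_Suc_Suc mult_Suc_right)
  have "(2 * real s + 1) * (2 * real s + 3) \<le> (2 * real s + 2)\<^sup>2"
    by (simp add: power2_eq_square algebra_simps)
  then have "sqrt (2 * real s + 1) * sqrt (2 * real s + 3) \<le> 2 * real s + 2"
    by (simp add: real_le_lsqrt flip: real_sqrt_mult)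
  then have "(2 * (sqrt (2 * real s + 1) * c)) * (sqrt (2 * real s + 1) * sqrt (2 * real s + 3))
      \<le> (2 * (sqrt (2 * real s + 1) * c)) * (2 * real s + 2)"
    by (rule mult_left_mono) (simp add: c_def)
  also have "(2 * (sqrt (2 * real s + 1) * c)) * (sqrt (2 * real s + 1) * sqrt (2 * real s + 3))
      = 2 * (sqrt (2 * real s + 1) * sqrt (2 * real s + 1)) * c * sqrt (2 * real s + 3)"
    by (simp only: mult_ac)
  also have "\<dots> = (real s + 1) * real (2 * Suc s choose Suc s) * sqrt (2 * real s + 3)"
    unfolding rec by simp
  also have "(2 * (sqrt (2 * real s + 1) * c)) * (2 * real s + 2) = (real s + 1) * (4 * (c * sqrt (2 * real s + 1)))"
    by (simp add: algebra_simps)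
  finally have "(real s + 1) * (real (2 * Suc s choose Suc s) * sqrt (2 * real s + 3))
      \<le> (real s + 1) * (4 * (c * sqrt (2 * real s + 1)))" by (simp only: mult_ac)
  then have "real (2 * Suc s choose Suc s) * sqrt (2 * real s + 3) \<le> 4 * (c * sqrt (2 * real s + 1))"
    by (rule mult_left_le_imp_le) simp
  also have "\<dots> \<le> 4 * 4 ^ s" using Suc.IH by (simp add: c_def)
  finally show ?case by (simp add: add.commute)
qed

lemma binomial_le_power_div_sqrt:
  assumes "0 < n"
  shows "real (n choose k) \<le> 2 ^ n / sqrt n"
proof -
  have even_bound: "real ((2 * s) choose k) * sqrt (2 * real s + 1) \<le> 2 ^ (2 * s)" for s k
  proof -
    have "real ((2 * s) choose k) * sqrt (2 * real s + 1) \<le> real ((2 * s) choose s) * sqrt (2 * real s + 1)"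
      by (intro mult_right_mono of_nat_mono binomial_maximum') auto
    also have "\<dots> \<le> 2 ^ (2 * s)" using central_binomial_upper_bound[of s] by (simp add: power_mult)
    finally show ?thesis .
  qed
  have "real (n choose k) * sqrt n \<le> 2 ^ n"
  proof (cases "even n")
    case True
    then obtain s where n: "n = 2 * s" by blast
    have "real (n choose k) * sqrt n \<le> real (n choose k) * sqrt (2 * real s + 1)"
      by (intro mult_left_mono) (auto simp: n)
    then show ?thesis using even_bound[of s k] by (simp add: n)
  next
    case False
    then obtain s where n: "n = Suc (2 * s)" by (metis oddE Suc_eq_plus1)
    \<comment> \<open>An odd row has two equal middle entries, and their sum is the central entry of
      the next row; this reduces to the even case.\<close>
    have half: "2 * real (n choose k) \<le> real (2 * Suc s choose Suc s)"
    proof -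
      have "n choose k \<le> n choose s" using binomial_maximum[of n k] by (simp add: n)
      moreover have "2 * Suc s choose Suc s = (n choose s) + (n choose Suc s)" by (simp add: n)
      moreover have "n choose Suc s = n choose s"
        using binomial_symmetric[of s n] by (simp add: n Suc_diff_le)
      ultimately show ?thesis by linarith
    qed
    have "2 * (real (n choose k) * sqrt n) = 2 * real (n choose k) * sqrt n" by simp
    also have "\<dots> \<le> real (2 * Suc s choose Suc s) * sqrt (2 * real (Suc s) + 1)"
      using half by (intro mult_mono) (auto simp: n)
    also have "\<dots> \<le> 2 ^ (2 * Suc s)" by (rule even_bound)
    finally show ?thesis by (simp add: n)
  qed
  then show ?thesis using assms by (simp add: field_simps)
qed

text \<open>This is the variance N/4 of the Binomial(N, 1/2) law times 4 * 2^N; Bernstein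
  polynomials at 1/2 are its weights and supply the factorial moments.\<close>

lemma binomial_variance:
  "(\<Sum>K\<le>N. (2 * real K - real N)\<^sup>2 * real (N choose K)) = real N * 2 ^ N"
proof -
  define B where "B K = Bernstein N K (1/2)" for K
  have B: "B K = real (N choose K) / 2 ^ N" if "K \<le> N" for K
  proof -
    have "(1/2::real) ^ K * (1/2) ^ (N - K) = (1/2) ^ N" using that by (simp flip: power_add)
    then show ?thesis by (simp add: B_def Bernstein_def mult.assoc power_divide)
  qed
  have "(\<Sum>K\<le>N. (2 * real K - real N)\<^sup>2 * B K)
      = (\<Sum>K\<le>N. 4 * (real K * (real K - 1) * B K) + (4 - 4 * real N) * (real K * B K) + (real N)\<^sup>2 * B K)"
    by (intro sum.cong refl) (simp add: power2_eq_square algebra_simps)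
  also have "\<dots> = 4 * (\<Sum>K\<le>N. real K * (real K - 1) * B K) + (4 - 4 * real N) * (\<Sum>K\<le>N. real K * B K)
      + (real N)\<^sup>2 * (\<Sum>K\<le>N. B K)"
    by (simp only: sum.distrib sum_distrib_left)
  also have "\<dots> = 4 * (real N * (real N - 1) * (1/2)\<^sup>2) + (4 - 4 * real N) * (real N * (1/2)) + (real N)\<^sup>2 * 1"
    unfolding B_def sum_kk_Bernstein sum_k_Bernstein sum_Bernstein ..
  also have "\<dots> = real N"
    by (simp add: power2_eq_square field_simps)
  finally have "(\<Sum>K\<le>N. (2 * real K - real N)\<^sup>2 * (real (N choose K) / 2 ^ N)) = real N"
    using B by simp
  then have "(\<Sum>K\<le>N. (2 * real K - real N)\<^sup>2 * real (N choose K)) / 2 ^ N = real N"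
    by (simp add: sum_divide_distrib)
  then show ?thesis by (simp add: field_simps)
qed

section \<open>Vanishing tie probability\<close>

text \<open>\<open>t\<close> is the truncation radius around half the number of observations.
  Central layers use the uniform cell bound \<open>D\<close>; outlying ones use their whole size,
  which by Vandermonde's identity dominates each cell.\<close>

lemma card_label_reject_bound:
  assumes mn: "2 \<le> m" "2 \<le> n" and \<alpha>: "0 \<le> \<alpha>" and t: "0 < t"
  shows "real (card (label_reject \<alpha> m n)) / 2 ^ (m + n)
    \<le> \<alpha> + 2 * ((2 * real t + 1) / sqrt (real m * real n) + real (m + n) / (4 * (real t)\<^sup>2))"
proof -
  define N where "N = m + n"
  define D where "D = 2 ^ N / sqrt (real m * real n)"
  define near where "near = {K. N div 2 \<le> K + t \<and> K \<le> N div 2 + t}"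
  define M where "M K = (if K \<in> near then D else real (N choose K))" for K
  have M: "real ((m choose k) * (n choose (K - k))) \<le> M K" if "k \<le> K" for K k
  proof (cases "K \<in> near")
    case True
    have "real ((m choose k) * (n choose (K - k))) \<le> 2 ^ m / sqrt m * (2 ^ n / sqrt n)"
      unfolding of_nat_mult using mn by (intro mult_mono binomial_le_power_div_sqrt) auto
    also have "\<dots> = D" by (simp add: D_def N_def power_add real_sqrt_mult)
    finally show ?thesis using True by (simp add: M_def)
  next
    case False
    have "(m choose k) * (n choose (K - k)) \<le> (\<Sum>j\<le>K. (m choose j) * (n choose (K - j)))"
      using that by (intro member_le_sum) auto
    also have "\<dots> = N choose K" by (simp add: N_def vandermonde)
    finally show ?thesis using False by (simp only: M_def if_False of_nat_le_iff)
  qed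
  have far: "4 * (real t)\<^sup>2 \<le> (2 * real K - real N)\<^sup>2" if "K \<notin> near" for K
  proof -
    \<comment> \<open>Leaving \<open>near\<close> is a strict inequality, and this absorbs the
      rounding in \<open>N div 2\<close>.\<close>
    have "N + 2 * t \<le> 2 * K \<or> 2 * K + 2 * t \<le> N" using that by (auto simp: near_def)
    then have "2 * real t \<le> \<bar>2 * real K - real N\<bar>" by linarith
    then have "(2 * real t)\<^sup>2 \<le> \<bar>2 * real K - real N\<bar>\<^sup>2" by (rule power_mono) simp
    then show ?thesis by (simp add: power_mult_distrib)
  qed
  have "near \<subseteq> {N div 2 - t..N div 2 + t}" by (auto simp: near_def)
  then have near: "finite near" "card near \<le> 2 * t + 1"
    using card_mono[of "{N div 2 - t..N div 2 + t}" near] finite_subset by auto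
  have "0 \<le> D" by (simp add: D_def)
  \<comment> \<open>Chebyshev's argument: outside \<open>near\<close> the factor (2K - N)^2/(4t^2)
    is at least 1, and inside it only adds a nonnegative term.\<close>
  have "(\<Sum>K\<le>N. M K) \<le> (\<Sum>K\<le>N. (if K \<in> near then D else 0)
      + (2 * real K - real N)\<^sup>2 * real (N choose K) / (4 * (real t)\<^sup>2))"
  proof (rule sum_mono)
    fix K
    show "M K \<le> (if K \<in> near then D else 0) + (2 * real K - real N)\<^sup>2 * real (N choose K) / (4 * (real t)\<^sup>2)"
    proof (cases "K \<in> near")
      case False
      then have "4 * (real t)\<^sup>2 * real (N choose K) \<le> (2 * real K - real N)\<^sup>2 * real (N choose K)"
        using far by (intro mult_right_mono) auto
      then show ?thesis using False t by (simp add: M_def field_simps)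
    qed (simp add: M_def)
  qed
  also have "\<dots> = (\<Sum>K\<le>N. if K \<in> near then D else 0) + real N * 2 ^ N / (4 * (real t)\<^sup>2)"
    by (simp add: sum.distrib binomial_variance flip: sum_divide_distrib)
  also have "(\<Sum>K\<le>N. if K \<in> near then D else 0) = real (card ({..N} \<inter> near)) * D"
    by (simp add: sum.If_cases)
  also have "\<dots> \<le> (2 * real t + 1) * D"
  proof (rule mult_right_mono[OF _ \<open>0 \<le> D\<close>])
    have "card ({..N} \<inter> near) \<le> 2 * t + 1"
      using near card_mono[of near "{..N} \<inter> near"] by simp
    then show "real (card ({..N} \<inter> near)) \<le> 2 * real t + 1" by linarith
  qed
  finally have sum: "(\<Sum>K\<le>m + n. M K) \<le> (2 * real t + 1) * D + real N * 2 ^ N / (4 * (real t)\<^sup>2)"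
    by (simp add: N_def)
  have "real (card (label_reject \<alpha> m n)) \<le> \<alpha> * 2 ^ N + 2 * (\<Sum>K\<le>m + n. M K)"
    unfolding N_def using M by (intro card_label_reject_le[OF mn \<alpha>])
  also have "\<dots> \<le> \<alpha> * 2 ^ N + 2 * ((2 * real t + 1) * D + real N * 2 ^ N / (4 * (real t)\<^sup>2))"
    by (intro add_left_mono mult_left_mono sum) simp
  also have "\<dots> = 2 ^ N * (\<alpha> + 2 * ((2 * real t + 1) / sqrt (real m * real n) + real N / (4 * (real t)\<^sup>2)))"
    by (simp add: D_def algebra_simps)
  finally show ?thesis by (simp add: N_def divide_le_eq mult.commute)
qed

lemma card_label_reject_eventually:
  assumes \<alpha>: "0 \<le> \<alpha>" and e: "0 < e"
  shows "\<exists>N0. \<forall>m\<ge>N0. \<forall>n\<ge>N0. real (card (label_reject \<alpha> m n)) / 2 ^ (m + n) \<le> \<alpha> + e"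
proof -
  \<comment> \<open>With \<open>t\<close> about \<open>\<tau>\<close> sqrt(m + n), the outlying
    layers cost at most 1/(4 \<open>\<tau>\<close>^2) = e/4.\<close>
  define \<tau> where "\<tau> = 1 / sqrt e"
  have \<tau>: "0 < \<tau>" "1 / (4 * \<tau>\<^sup>2) = e / 4" using e by (auto simp: \<tau>_def power_divide)
  \<comment> \<open>This makes 1/m and 1/n each at most 1/(2q^2) for q = 4(2 \<open>\<tau>\<close> +
    3)/e, so that (m + n)/(mn) = 1/m + 1/n <= 1/q^2 and the central layers cost at most e/4
    too.\<close>
  define N0 where "N0 = nat \<lceil>max 2 (2 * (4 * (2 * \<tau> + 3) / e)\<^sup>2)\<rceil>"
  have "real (card (label_reject \<alpha> m n)) / 2 ^ (m + n) \<le> \<alpha> + e" if mn: "N0 \<le> m" "N0 \<le> n" for m n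
  proof -
    have N0: "2 \<le> real N0" "2 * (4 * (2 * \<tau> + 3) / e)\<^sup>2 \<le> real N0"
      unfolding N0_def by linarith+
    then have mn2: "2 \<le> m" "2 \<le> n" using mn by linarith+
    define t where "t = nat \<lceil>\<tau> * sqrt (real (m + n))\<rceil>"
    have "0 < \<tau> * sqrt (real (m + n))" using \<tau> mn2 by simp
    then have t: "\<tau> * sqrt (real (m + n)) \<le> real t" "real t \<le> \<tau> * sqrt (real (m + n)) + 1" "0 < t"
      unfolding t_def by linarith+
    have "(\<tau> * sqrt (real (m + n)))\<^sup>2 \<le> (real t)\<^sup>2"
      using t(1) \<tau> by (intro power_mono) auto
    then have "real (m + n) / (4 * (real t)\<^sup>2) \<le> real (m + n) / (4 * (\<tau> * sqrt (real (m + n)))\<^sup>2)"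
      using \<open>0 < \<tau> * _\<close> t(3) by (intro divide_left_mono mult_pos_pos) auto
    also have "\<dots> = 1 / (4 * \<tau>\<^sup>2)" using mn2 by (simp add: power_mult_distrib)
    finally have far: "real (m + n) / (4 * (real t)\<^sup>2) \<le> e / 4" using \<tau> by simp
    have "1 \<le> sqrt (real (m + n))" using mn2 by simp
    \<comment> \<open>The 3 gathers twice the rounding error 1 of \<open>t\<close> and the extra 1,
      each absorbed by sqrt(m + n) >= 1.\<close>
    then have "2 * real t + 1 \<le> (2 * \<tau> + 3) * sqrt (real (m + n))"
      using t(2) unfolding distrib_right by linarith
    then have "(2 * real t + 1) / sqrt (real m * real n) \<le> (2 * \<tau> + 3) * sqrt (real (m + n)) / sqrt (real m * real n)"
      by (rule divide_right_mono) simp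
    also have "\<dots> = (2 * \<tau> + 3) * sqrt (real (m + n) / (real m * real n))"
      by (simp add: real_sqrt_divide)
    also have "\<dots> \<le> (2 * \<tau> + 3) * (e / (4 * (2 * \<tau> + 3)))"
    proof (intro mult_left_mono real_le_lsqrt)
      define q where "q = 4 * (2 * \<tau> + 3) / e"
      have q: "0 < q" "2 * q\<^sup>2 \<le> real N0" using N0 \<tau> e by (auto simp: q_def)
      have inv: "1 / real i \<le> 1 / (2 * q\<^sup>2)" if "N0 \<le> i" for i
      proof (rule divide_left_mono)
        show "2 * q\<^sup>2 \<le> real i" using q(2) that by (meson of_nat_le_iff order_trans)
        moreover have "0 < 2 * q\<^sup>2" using q(1) by simp
        ultimately show "0 < real i * (2 * q\<^sup>2)" by (meson mult_pos_pos order_less_le_trans)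
      qed simp
      have "real (m + n) / (real m * real n) = 1 / real n + 1 / real m"
        using mn2 by (simp add: field_simps)
      also have "\<dots> \<le> 1 / q\<^sup>2" using inv[OF mn(1)] inv[OF mn(2)] by simp
      finally show "real (m + n) / (real m * real n) \<le> (e / (4 * (2 * \<tau> + 3)))\<^sup>2"
        by (simp add: q_def power_divide)
    qed (use \<tau> e in auto)
    also have "\<dots> = e / 4" using \<tau>(1) by (simp add: field_simps)
    finally have "(2 * real t + 1) / sqrt (real m * real n) \<le> e / 4" .
    then have "(2 * real t + 1) / sqrt (real m * real n) + real (m + n) / (4 * (real t)\<^sup>2) \<le> e / 4 + e / 4"
      using far by (rule add_mono)
    then have "\<alpha> + 2 * ((2 * real t + 1) / sqrt (real m * real n) + real (m + n) / (4 * (real t)\<^sup>2)) \<le> \<alpha> + e"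
      by (simp only: mult_2)
    then show ?thesis by (rule order_trans[OF card_label_reject_bound[OF mn2 \<alpha> t(3)]])
  qed
  then show ?thesis by blast
qed

section \<open>Measurability in the CvM functional and a lower bound for it\<close>

lemma real_distribution_proj:
  assumes "prob_space P" "sets P = sets borel"
  shows "real_distribution (distr P borel (\<lambda>x. \<beta> \<bullet> x))"
proof (rule prob_space.real_distribution_distr[OF assms(1)])
  show "(\<lambda>x. \<beta> \<bullet> x) \<in> borel_measurable P"
    unfolding measurable_cong_sets[OF assms(2) refl]
    by (intro borel_measurable_continuous_onI continuous_intros)
qed

lemma proj_cdf_eq:
  assumes "sets P = sets borel"
  shows "proj_cdf P \<beta> t = measure P {x. \<beta> \<bullet> x \<le> t}"
proof -
  have [measurable_cong]: "sets P = sets borel" by fact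
  have sp: "space P = UNIV" using sets_eq_imp_space_eq[OF assms] by simp
  show ?thesis
    unfolding proj_cdf_def cdf_def by (subst measure_distr) (auto simp: vimage_def sp)
qed

text \<open>The value is the P-measure of a section of the measurable set of triples with inner
  product at most t, and such section measures are jointly measurable.\<close>

lemma measurable_proj_cdf:
  fixes P :: "'a::euclidean_space measure"
  assumes "prob_space P" "sets P = sets borel"
  shows "(\<lambda>(\<beta>, t). proj_cdf P \<beta> t) \<in> borel_measurable (borel \<Otimes>\<^sub>M borel)"
proof -
  interpret prob_space P by fact
  have [measurable_cong]: "sets P = sets borel" by fact
  have sp: "space P = UNIV" using sets_eq_imp_space_eq[OF assms(2)] by simp
  define Q where "Q = {w \<in> space (((borel :: 'a measure) \<Otimes>\<^sub>M (borel :: real measure)) \<Otimes>\<^sub>M P).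
    fst (fst w) \<bullet> snd w \<le> snd (fst w)}"
  have "Q \<in> sets ((borel \<Otimes>\<^sub>M borel) \<Otimes>\<^sub>M P)" unfolding Q_def by measurable
  then have "(\<lambda>w. emeasure P (Pair w -` Q)) \<in> borel_measurable (borel \<Otimes>\<^sub>M borel)"
    by (rule measurable_emeasure_Pair)
  then have "(\<lambda>w. measure P (Pair w -` Q)) \<in> borel_measurable (borel \<Otimes>\<^sub>M borel)"
    unfolding measure_def by measurable
  moreover have "measure P (Pair w -` Q) = (case w of (\<beta>, t) \<Rightarrow> proj_cdf P \<beta> t)" for w
    by (cases w) (auto simp: Q_def proj_cdf_eq[OF assms(2)] space_pair_measure sp vimage_def intro!: arg_cong[where f="measure P"])
  ultimately show ?thesis by simp
qed

context
  fixes PX PY :: "'a::euclidean_space measure" and \<theta> :: real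
  assumes PX: "prob_space PX" "sets PX = sets borel"
    and PY: "prob_space PY" "sets PY = sets borel"
    and \<theta>: "0 \<le> \<theta>" "\<theta> \<le> 1"
begin

private abbreviation mix :: "'a \<Rightarrow> real \<Rightarrow> real" where
  "mix \<beta> t \<equiv> \<theta> * proj_cdf PX \<beta> t + (1 - \<theta>) * proj_cdf PY \<beta> t"

lemma mix_cdf:
  shows mix_mono: "s \<le> t \<Longrightarrow> mix \<beta> s \<le> mix \<beta> t"
    and mix_right_cont: "continuous (at_right a) (mix \<beta>)"
    and mix_at_bot: "(mix \<beta> \<longlongrightarrow> 0) at_bot"
    and mix_at_top: "(mix \<beta> \<longlongrightarrow> 1) at_top"
proof -
  interpret X: real_distribution "distr PX borel (\<lambda>x. \<beta> \<bullet> x)" by (rule real_distribution_proj[OF PX])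
  interpret Y: real_distribution "distr PY borel (\<lambda>x. \<beta> \<bullet> x)" by (rule real_distribution_proj[OF PY])
  show "mix \<beta> s \<le> mix \<beta> t" if "s \<le> t"
    unfolding proj_cdf_def using \<theta> that
    by (intro add_mono mult_left_mono X.cdf_nondecreasing Y.cdf_nondecreasing) auto
  show "continuous (at_right a) (mix \<beta>)"
    unfolding proj_cdf_def by (intro continuous_intros X.cdf_is_right_cont Y.cdf_is_right_cont)
  have "((\<lambda>t. mix \<beta> t) \<longlongrightarrow> \<theta> * 0 + (1 - \<theta>) * 0) at_bot"
    unfolding proj_cdf_def by (intro tendsto_intros X.cdf_lim_at_bot Y.cdf_lim_at_bot)
  then show "(mix \<beta> \<longlongrightarrow> 0) at_bot" by simp
  have "((\<lambda>t. mix \<beta> t) \<longlongrightarrow> \<theta> * 1 + (1 - \<theta>) * 1) at_top"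
    unfolding proj_cdf_def by (intro tendsto_intros X.cdf_lim_at_top_prob Y.cdf_lim_at_top_prob)
  then show "(mix \<beta> \<longlongrightarrow> 1) at_top" by simp
qed

lemma real_distribution_mix: "real_distribution (interval_measure (mix \<beta>))"
  by (intro real_distribution_interval_measure mix_cdf)

text \<open>The integrating measure varies with the direction, so measurability of the inner
  integral requires a probability kernel. It suffices to test half-lines, which generate the Borel
  sets and on which the measure is \<open>mix\<close> itself.\<close>

lemma measurable_mix_kernel: "(\<lambda>\<beta>. interval_measure (mix \<beta>)) \<in> borel \<rightarrow>\<^sub>M prob_algebra borel"
proof (rule measurable_prob_algebra_generated[where \<Omega>=UNIV and G="range atMost"])
  show "sets borel = sigma_sets UNIV (range atMost :: real set set)"
    by (subst borel_eq_atMost) (auto simp: image_def)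
  show "Int_stable (range atMost :: real set set)"
    by (auto simp: Int_stable_def)
  show "prob_space (interval_measure (mix \<beta>))" for \<beta>
    using real_distribution_mix by (simp add: real_distribution_def)
  fix A :: "real set" assume "A \<in> range atMost"
  then obtain t where A: "A = {..t}" by auto
  have "emeasure (interval_measure (mix \<beta>)) A = ennreal (mix \<beta> t)" for \<beta>
  proof -
    interpret real_distribution "interval_measure (mix \<beta>)" by (rule real_distribution_mix)
    have "cdf (interval_measure (mix \<beta>)) = mix \<beta>" by (intro cdf_interval_measure mix_cdf)
    then have "measure (interval_measure (mix \<beta>)) {..t} = mix \<beta> t" by (metis cdf_def)
    then show ?thesis by (simp add: A emeasure_eq_measure)
  qed
  moreover have "(\<lambda>\<beta>. ennreal (mix \<beta> t)) \<in> borel_measurable borel"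
  proof -
    have [measurable]: "(\<lambda>\<beta>. proj_cdf PX \<beta> t) \<in> borel_measurable borel"
      "(\<lambda>\<beta>. proj_cdf PY \<beta> t) \<in> borel_measurable borel"
      using measurable_compose[OF measurable_Pair2'[of t borel borel] measurable_proj_cdf[OF PX]]
        measurable_compose[OF measurable_Pair2'[of t borel borel] measurable_proj_cdf[OF PY]] by auto
    show ?thesis by measurable
  qed
  ultimately show "(\<lambda>\<beta>. emeasure (interval_measure (mix \<beta>)) A) \<in> borel_measurable borel" by simp
qed auto

private definition inner_cvm :: "'a \<Rightarrow> real" where
  "inner_cvm \<beta> = (\<integral>t. (proj_cdf PX \<beta> t - proj_cdf PY \<beta> t)\<^sup>2 \<partial>interval_measure (mix \<beta>))"

lemma measurable_proj_cdf_fixed: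
  assumes P: "prob_space P" "sets P = sets borel"
  shows "proj_cdf P \<beta> \<in> borel_measurable borel"
  using measurable_compose[OF measurable_Pair1'[of \<beta> borel borel] measurable_proj_cdf[OF P]] by simp

lemma cdf_diff_sq_le_1: "(proj_cdf PX \<beta> t - proj_cdf PY \<beta> t)\<^sup>2 \<le> 1"
proof -
  interpret X: prob_space PX by fact
  interpret Y: prob_space PY by fact
  have "\<bar>proj_cdf PX \<beta> t - proj_cdf PY \<beta> t\<bar> \<le> 1"
    unfolding proj_cdf_eq[OF PX(2)] proj_cdf_eq[OF PY(2)]
    using X.prob_le_1[of "{x. \<beta> \<bullet> x \<le> t}"] Y.prob_le_1[of "{x. \<beta> \<bullet> x \<le> t}"]
      measure_nonneg[of PX "{x. \<beta> \<bullet> x \<le> t}"] measure_nonneg[of PY "{x. \<beta> \<bullet> x \<le> t}"] by linarith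
  then show ?thesis by (simp add: abs_square_le_1)
qed

lemma integrable_cdf_diff_sq:
  "integrable (interval_measure (mix \<beta>)) (\<lambda>t. (proj_cdf PX \<beta> t - proj_cdf PY \<beta> t)\<^sup>2)"
proof -
  interpret real_distribution "interval_measure (mix \<beta>)" by (rule real_distribution_mix)
  note [measurable] = measurable_proj_cdf_fixed[OF PX] measurable_proj_cdf_fixed[OF PY]
  show ?thesis
    by (rule integrable_const_bound[where B=1]) (auto simp: cdf_diff_sq_le_1)
qed

lemma inner_cvm_bounds: "0 \<le> inner_cvm \<beta>" "inner_cvm \<beta> \<le> 1"
proof -
  interpret real_distribution "interval_measure (mix \<beta>)" by (rule real_distribution_mix)
  show "0 \<le> inner_cvm \<beta>" unfolding inner_cvm_def by simp
  have "inner_cvm \<beta> \<le> (\<integral>t. 1 \<partial>interval_measure (mix \<beta>))"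
    unfolding inner_cvm_def by (intro integral_mono integrable_cdf_diff_sq) (auto simp: cdf_diff_sq_le_1)
  then show "inner_cvm \<beta> \<le> 1" using prob_space by simp
qed

text \<open>A lower bound on the outer integral depends on this: the integral of a nonintegrable
  function is 0 by convention, so a pointwise lower bound alone would give nothing.\<close>

lemma measurable_inner_cvm: "inner_cvm \<in> borel_measurable borel"
proof -
  note [measurable] = measurable_proj_cdf[OF PX] measurable_proj_cdf[OF PY]
  have f: "(\<lambda>(\<beta>, t). ennreal ((proj_cdf PX \<beta> t - proj_cdf PY \<beta> t)\<^sup>2)) \<in> borel_measurable (borel \<Otimes>\<^sub>M borel)"
    by measurable
  have [measurable]: "(\<lambda>\<beta>. \<integral>\<^sup>+t. ennreal ((proj_cdf PX \<beta> t - proj_cdf PY \<beta> t)\<^sup>2) \<partial>interval_measure (mix \<beta>)) \<in> borel_measurable borel"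
    by (rule nn_integral_measurable_subprob_algebra2[OF f measurable_prob_algebraD[OF measurable_mix_kernel]])
  have inner: "inner_cvm \<beta> = enn2real (\<integral>\<^sup>+t. ennreal ((proj_cdf PX \<beta> t - proj_cdf PY \<beta> t)\<^sup>2) \<partial>interval_measure (mix \<beta>))" for \<beta>
    unfolding inner_cvm_def using integrable_cdf_diff_sq
    by (intro integral_eq_nn_integral) auto
  show ?thesis unfolding inner[abs_def] by measurable
qed

text \<open>For a direction in \<open>K\<close> the squared gap is at least \<kappa>^2 on (0, 1],
  and the X part of the mixture alone gives (0, 1] mass at least \<theta>\<kappa>. The product is
  the inner integral's share; other directions contribute at least 0.\<close>

lemma cvm_dist_sq_ge:
  assumes K: "K \<in> sets borel" and \<kappa>: "0 \<le> \<kappa>"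
    and gap: "\<And>\<beta> t. \<beta> \<in> K \<Longrightarrow> 0 < t \<Longrightarrow> t \<le> 1 \<Longrightarrow> \<kappa> \<le> proj_cdf PX \<beta> t - proj_cdf PY \<beta> t"
    and mass: "\<And>\<beta>. \<beta> \<in> K \<Longrightarrow> \<kappa> \<le> proj_cdf PX \<beta> 1 - proj_cdf PX \<beta> 0"
  shows "sqrt (\<theta> * \<kappa> ^ 3 * measure uniform_sphere K) \<le> cvm_dist \<theta> PX PY"
proof -
  have inner: "\<theta> * \<kappa> ^ 3 \<le> inner_cvm \<beta>" if "\<beta> \<in> K" for \<beta>
  proof -
    interpret real_distribution "interval_measure (mix \<beta>)" by (rule real_distribution_mix)
    interpret Y: real_distribution "distr PY borel (\<lambda>x. \<beta> \<bullet> x)" by (rule real_distribution_proj[OF PY])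
    have "\<theta> * \<kappa> + (1 - \<theta>) * 0 \<le> \<theta> * (proj_cdf PX \<beta> 1 - proj_cdf PX \<beta> 0) + (1 - \<theta>) * (proj_cdf PY \<beta> 1 - proj_cdf PY \<beta> 0)"
      using \<theta> mass[OF that] Y.cdf_nondecreasing[of 0 1]
      by (intro add_mono mult_left_mono) (auto simp: proj_cdf_def)
    also have "\<dots> = measure (interval_measure (mix \<beta>)) {0<..1}"
      by (subst measure_interval_measure_Ioc[OF zero_le_one mix_mono mix_right_cont]) (auto simp: algebra_simps)
    finally have "\<theta> * \<kappa> * \<kappa>\<^sup>2 \<le> measure (interval_measure (mix \<beta>)) {0<..1} * \<kappa>\<^sup>2"
      by (intro mult_right_mono) auto
    also have "\<dots> = (\<integral>t. \<kappa>\<^sup>2 * indicator {0<..1} t \<partial>interval_measure (mix \<beta>))" by simp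
    also have "\<dots> \<le> inner_cvm \<beta>"
      unfolding inner_cvm_def
    proof (intro integral_mono integrable_cdf_diff_sq)
      show "\<kappa>\<^sup>2 * indicator {0<..1} t \<le> (proj_cdf PX \<beta> t - proj_cdf PY \<beta> t)\<^sup>2" for t
        using power_mono[OF gap[OF that, of t] \<kappa>, of 2] by (auto simp: indicator_def)
    qed (auto simp: emeasure_eq_measure)
    finally show ?thesis by (simp add: power3_eq_cube power2_eq_square mult_ac)
  qed
  interpret S: prob_space "uniform_sphere :: 'a measure" by (rule prob_space_uniform_sphere)
  have [measurable_cong]: "sets (uniform_sphere :: 'a measure) = sets borel" by (simp add: uniform_sphere_def)
  have KS: "K \<in> sets uniform_sphere" using K by (simp add: uniform_sphere_def)
  have "\<theta> * \<kappa> ^ 3 * measure uniform_sphere K = (\<integral>\<beta>. \<theta> * \<kappa> ^ 3 * indicator K \<beta> \<partial>uniform_sphere)"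
    using K by (simp add: uniform_sphere_def)
  also have "\<dots> \<le> (\<integral>\<beta>. inner_cvm \<beta> \<partial>uniform_sphere)"
  proof (rule integral_mono)
    show "integrable uniform_sphere (\<lambda>\<beta>. \<theta> * \<kappa> ^ 3 * indicator K \<beta> :: real)"
      using KS by (intro integrable_mult_right integrable_real_indicator) (auto simp: S.emeasure_eq_measure)
    show "integrable uniform_sphere inner_cvm"
      using measurable_inner_cvm inner_cvm_bounds
      by (intro S.integrable_const_bound[where B=1]) auto
    show "\<theta> * \<kappa> ^ 3 * indicator K \<beta> \<le> inner_cvm \<beta>" for \<beta>
      using inner inner_cvm_bounds by (auto simp: indicator_def)
  qed
  finally show ?thesis unfolding cvm_dist_def inner_cvm_def by (rule real_sqrt_le_mono)
qed

end

section \<open>Uniform distributions on two unit balls\<close>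

text \<open>Balls rather than two atoms, since admissibility asks for continuous distribution
  functions of the projections. When the balls are disjoint, their equal volumes make this an even
  mixture.\<close>

definition ball_pair :: "'a::euclidean_space \<Rightarrow> 'a \<Rightarrow> 'a measure" where
  "ball_pair a b = uniform_measure lborel (ball a 1 \<union> ball b 1)"

lemma sets_ball_pair [simp]: "sets (ball_pair a b) = sets borel"
  by (simp add: ball_pair_def)

lemma unit_ball_vol_DIM_neq_0: "unit_ball_vol (real DIM('a::euclidean_space)) \<noteq> 0"
  by (metis of_nat_0_le_iff unit_ball_vol_pos less_irrefl)

lemma disjoint_unit_balls:
  fixes a b :: "'a::real_normed_vector"
  assumes "2 \<le> dist a b"
  shows "ball a 1 \<inter> ball b 1 = {}"
proof -
  have "dist a b < 2" if "dist a x < 1" "dist b x < 1" for x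
    using dist_triangle_less_add[of a x 1 b 1] that by (simp add: dist_commute)
  then show ?thesis using assms by fastforce
qed

context
  fixes a b :: "'a::euclidean_space"
  assumes dist: "2 \<le> dist a b"
begin

lemma measure_ball_pair_support:
  "emeasure lborel (ball a 1 \<union> ball b 1) = ennreal (2 * unit_ball_vol (real DIM('a)))"
  "measure lborel (ball a 1 \<union> ball b 1) = 2 * unit_ball_vol (real DIM('a))"
proof -
  have "emeasure lborel (ball a 1 \<union> ball b 1) = emeasure lborel (ball a 1) + emeasure lborel (ball b 1)"
    using disjoint_unit_balls[OF dist] by (intro plus_emeasure[symmetric]) auto
  then show *: "emeasure lborel (ball a 1 \<union> ball b 1) = ennreal (2 * unit_ball_vol (real DIM('a)))"
    by (simp add: emeasure_ball flip: ennreal_plus)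
  show "measure lborel (ball a 1 \<union> ball b 1) = 2 * unit_ball_vol (real DIM('a))"
    by (simp add: measure_def *)
qed

lemma prob_space_ball_pair: "prob_space (ball_pair a b)"
  unfolding ball_pair_def by (rule prob_space_uniform_measure) (auto simp: measure_ball_pair_support ennreal_eq_0_iff not_le)

lemma measure_ball_pair:
  assumes "A \<in> sets borel"
  shows "measure (ball_pair a b) A = measure lborel ((ball a 1 \<union> ball b 1) \<inter> A) / (2 * unit_ball_vol (real DIM('a)))"
  unfolding ball_pair_def using assms
  by (subst measure_uniform_measure) (auto simp: measure_ball_pair_support ennreal_eq_0_iff not_le)

lemma measure_ball_pair_ge:
  assumes A: "A \<in> sets borel" and sub: "ball c r \<subseteq> A" "ball c r \<subseteq> ball a 1" and r: "0 \<le> r"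
  shows "r ^ DIM('a) / 2 \<le> measure (ball_pair a b) A"
proof -
  have "measure lborel (ball c r) \<le> measure lborel ((ball a 1 \<union> ball b 1) \<inter> A)"
  proof (rule measure_mono_fmeasurable)
    show "(ball a 1 \<union> ball b 1) \<inter> A \<in> fmeasurable lborel"
    proof (rule fmeasurableI2)
      show "ball a 1 \<union> ball b 1 \<in> fmeasurable lborel"
        by (rule fmeasurableI) (auto simp: measure_ball_pair_support)
    qed (use A in auto)
  qed (use sub in auto)
  then have "unit_ball_vol (real DIM('a)) * r ^ DIM('a) \<le> measure lborel ((ball a 1 \<union> ball b 1) \<inter> A)"
    using content_ball[OF r, of c] by simp
  then have "unit_ball_vol (real DIM('a)) * r ^ DIM('a) / (2 * unit_ball_vol (real DIM('a))) \<le> measure (ball_pair a b) A"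
    unfolding measure_ball_pair[OF A] by (rule divide_right_mono) simp
  then show ?thesis by (simp add: unit_ball_vol_DIM_neq_0)
qed

lemma measure_ball_pair_eq_0:
  assumes "A \<in> sets borel" "A \<inter> ball a 1 = {}" "A \<inter> ball b 1 = {}"
  shows "measure (ball_pair a b) A = 0"
proof -
  have "(ball a 1 \<union> ball b 1) \<inter> A = {}" using assms(2,3) by auto
  then show ?thesis using measure_ball_pair[OF assms(1)] by simp
qed

lemma measure_ball_pair_balls:
  "measure (ball_pair a b) (ball a 1) = 1/2" "measure (ball_pair a b) (ball b 1) = 1/2"
  by (simp_all add: measure_ball_pair Int_absorb1 content_ball unit_ball_vol_DIM_neq_0)

text \<open>A jump at t would require the hyperplane of points projecting to t to have positive
  volume.\<close>

lemma continuous_proj_cdf_ball_pair: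
  assumes "\<beta> \<noteq> 0"
  shows "continuous_on UNIV (proj_cdf (ball_pair a b) \<beta>)"
proof -
  interpret D: real_distribution "distr (ball_pair a b) borel (\<lambda>x. \<beta> \<bullet> x)"
    by (rule real_distribution_proj[OF prob_space_ball_pair sets_ball_pair])
  have "measure (distr (ball_pair a b) borel (\<lambda>x. \<beta> \<bullet> x)) {t} = 0" for t
  proof -
    have "{x. \<beta> \<bullet> x = t} \<in> null_sets lebesgue"
      using negligible_hyperplane[of \<beta> t] assms by (simp add: negligible_iff_null_sets)
    moreover have meas: "{x. \<beta> \<bullet> x = t} \<in> sets borel" by measurable
    ultimately have null: "{x. \<beta> \<bullet> x = t} \<in> null_sets lborel"
      by (simp add: null_sets_def)
    have "measure (distr (ball_pair a b) borel (\<lambda>x. \<beta> \<bullet> x)) {t} = measure (ball_pair a b) {x. \<beta> \<bullet> x = t}"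
      by (subst measure_distr) (auto simp: ball_pair_def vimage_def)
    also have "\<dots> = 0"
      unfolding measure_ball_pair[OF meas]
      using null_set_Int1[OF null, of "ball a 1 \<union> ball b 1"] by (simp add: measure_eq_0_null_sets Int_commute)
    finally show ?thesis .
  qed
  then show ?thesis unfolding proj_cdf_def by (simp add: continuous_on_eq_continuous_at D.isCont_cdf)
qed

end

lemma admissible_ball_pair:
  fixes a b a' b' :: "'a::euclidean_space"
  assumes "2 \<le> dist a b" "2 \<le> dist a' b'"
  shows "admissible (ball_pair a b) (ball_pair a' b')"
proof -
  have "AE \<beta> in uniform_sphere. (\<beta>::'a) \<noteq> 0"
    using AE_uniform_sphere by eventually_elim auto
  then have "AE \<beta> in uniform_sphere. continuous_on UNIV (proj_cdf (ball_pair a b) \<beta>)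
      \<and> continuous_on UNIV (proj_cdf (ball_pair a' b') \<beta>)"
    by eventually_elim (simp add: continuous_proj_cdf_ball_pair assms)
  then show ?thesis unfolding admissible_def using assms by (simp add: prob_space_ball_pair)
qed

section \<open>Separation in directions close to e\<close>

text \<open>The threshold 1/2 matches the shift 4e: the shifted centre projects beyond 4 * 1/2 = 2,
  so its unit ball projects beyond 1 and misses the window (0, 1].\<close>

definition spherical_cap :: "'a::euclidean_space \<Rightarrow> 'a set" where
  "spherical_cap e = {\<beta>. norm \<beta> = 1 \<and> 1/2 < \<beta> \<bullet> e}"

lemma spherical_cap_sets [measurable]: "spherical_cap e \<in> sets borel"
  unfolding spherical_cap_def by measurable

text \<open>The sphere carries the radial image of the unit ball, so a small ball projecting into
  the cap suffices. Around e/2 with radius 1/8, points have inner product with e above 3/8 and norm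
  below 5/8, a ratio above 3/5.\<close>

lemma measure_spherical_cap_pos:
  fixes e :: "'a::euclidean_space"
  assumes e: "norm e = 1"
  shows "0 < measure uniform_sphere (spherical_cap e)"
proof -
  define f where "f x = x /\<^sub>R norm x" for x :: 'a
  have f [measurable]: "f \<in> borel_measurable borel" unfolding f_def by measurable
  define V where "V = unit_ball_vol (real DIM('a))"
  have V: "0 < V" by (simp add: V_def)
  have em: "emeasure lborel (ball (0::'a) 1) = ennreal V" by (simp add: emeasure_ball V_def)
  have pre: "f -` spherical_cap e \<in> sets borel"
    using measurable_sets[OF f spherical_cap_sets[of e]] by simp
  have "ball (e /\<^sub>R 2) (1/8) \<subseteq> ball 0 1 \<inter> f -` spherical_cap e"
  proof
    fix x assume "x \<in> ball (e /\<^sub>R 2) (1/8)"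
    then have x: "norm (x - e /\<^sub>R 2) < 1/8" by (simp add: dist_norm norm_minus_commute)
    have ee: "e \<bullet> e = 1" using e by (simp add: norm_eq_1)
    have "norm x \<le> norm (e /\<^sub>R 2) + norm (x - e /\<^sub>R 2)"
      using norm_triangle_ineq[of "e /\<^sub>R 2" "x - e /\<^sub>R 2"] by simp
    then have nx: "norm x < 5/8" using x e by simp
    have "\<bar>(x - e /\<^sub>R 2) \<bullet> e\<bar> \<le> norm (x - e /\<^sub>R 2)"
      using Cauchy_Schwarz_ineq2[of "x - e /\<^sub>R 2" e] e by simp
    then have xe: "3/8 < x \<bullet> e" using x by (simp add: inner_diff_left ee)
    then have "x \<noteq> 0" by auto
    then have "1/2 < f x \<bullet> e" using nx xe by (simp add: f_def field_simps)
    moreover have "norm (f x) = 1" using \<open>x \<noteq> 0\<close> by (simp add: f_def)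
    ultimately show "x \<in> ball 0 1 \<inter> f -` spherical_cap e"
      using nx by (simp add: spherical_cap_def)
  qed
  then have "measure lborel (ball (e /\<^sub>R 2) (1/8)) \<le> measure lborel (ball 0 1 \<inter> f -` spherical_cap e)"
  proof (rule measure_mono_fmeasurable)
    show "ball 0 1 \<inter> f -` spherical_cap e \<in> fmeasurable lborel"
    proof (rule fmeasurableI2)
      show "ball (0::'a) 1 \<in> fmeasurable lborel" by (rule fmeasurableI) (auto simp: em)
    qed (use pre in auto)
  qed auto
  moreover have "0 < measure lborel (ball (e /\<^sub>R 2) (1/8))" by (simp add: content_ball)
  ultimately have pos: "0 < measure lborel (ball 0 1 \<inter> f -` spherical_cap e)" by linarith
  have "measure uniform_sphere (spherical_cap e) = measure (uniform_measure lborel (ball 0 1)) (f -` spherical_cap e)"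
    unfolding uniform_sphere_def f_def[symmetric, abs_def] by (subst measure_distr) auto
  also have "\<dots> = measure lborel (ball 0 1 \<inter> f -` spherical_cap e) / measure lborel (ball (0::'a) 1)"
    using V pre by (subst measure_uniform_measure) (auto simp: em ennreal_eq_0_iff)
  finally show ?thesis using pos V by (simp add: measure_def em)
qed

text \<open>The unit ball at 0 contains the balls of radius 1/2 around -\<beta>/2 and \<beta>/2,
  which project into (-1, 0) and (0, 1). Each has X-mass (1/2)^d/2, in dimension d. The first bounds
  the distribution function of X on (0, 1] from below, where that of Y vanishes; the second bounds
  the mass there. The bound is free of \<open>R\<close>.\<close>

lemma cvm_dist_ball_pair_ge:
  fixes e :: "'a::euclidean_space"
  assumes e: "norm e = 1" and R: "2 \<le> R" and \<theta>: "0 \<le> \<theta>" "\<theta> \<le> 1"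
  shows "sqrt (\<theta> * ((1/2) ^ DIM('a) / 2) ^ 3 * measure uniform_sphere (spherical_cap e))
    \<le> cvm_dist \<theta> (ball_pair 0 (R *\<^sub>R e)) (ball_pair (4 *\<^sub>R e) ((R + 4) *\<^sub>R e))"
proof -
  let ?X = "ball_pair 0 (R *\<^sub>R e)" and ?Y = "ball_pair (4 *\<^sub>R e) ((R + 4) *\<^sub>R e)"
  have dX: "2 \<le> dist 0 (R *\<^sub>R e)" using e R by simp
  have dY: "2 \<le> dist (4 *\<^sub>R e) ((R + 4) *\<^sub>R e)"
    using e R by (simp add: dist_norm flip: scaleR_diff_left)
  interpret X: prob_space ?X by (rule prob_space_ball_pair[OF dX])
  interpret Y: prob_space ?Y by (rule prob_space_ball_pair[OF dY])
  have meas: "{x. \<beta> \<bullet> x \<le> t} \<in> sets borel" for \<beta> :: 'a and t by measurable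
  have cs: "\<bar>\<beta> \<bullet> (x - c)\<bar> < r" if "norm \<beta> = 1" "x \<in> ball c r" for \<beta> x c :: 'a and r
  proof -
    have "\<bar>\<beta> \<bullet> (x - c)\<bar> \<le> norm (x - c)" using Cauchy_Schwarz_ineq2[of \<beta> "x - c"] that by simp
    then show ?thesis using that(2) by (simp add: dist_norm norm_minus_commute)
  qed
  have half: "ball (s *\<^sub>R \<beta>) (1/2) \<subseteq> ball 0 1" if "norm \<beta> = 1" "\<bar>s\<bar> = 1/2" for \<beta> :: 'a and s
    using that by (intro ball_subset_ball_iff[THEN iffD2]) (auto simp: dist_norm)
  show ?thesis
  proof (rule cvm_dist_sq_ge)
    fix \<beta> :: 'a and t :: real
    assume \<beta>: "\<beta> \<in> spherical_cap e"
    then have b1: "norm \<beta> = 1" "\<beta> \<bullet> \<beta> = 1" and be: "1/2 < \<beta> \<bullet> e"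
      by (auto simp: spherical_cap_def norm_eq_1)
    have slab: "s - 1/2 < \<beta> \<bullet> x \<and> \<beta> \<bullet> x < s + 1/2" if "x \<in> ball (s *\<^sub>R \<beta>) (1/2)" for s x
    proof -
      have "\<bar>\<beta> \<bullet> x - s\<bar> < 1/2" using cs[OF b1(1) that] b1(2) by (simp add: inner_diff_right)
      then show ?thesis by linarith
    qed
    {
      assume t: "0 < t" "t \<le> 1"
      have "(1/2) ^ DIM('a) / 2 \<le> measure ?X {x. \<beta> \<bullet> x \<le> t}"
      proof (rule measure_ball_pair_ge[OF dX meas])
        show "ball ((-1/2) *\<^sub>R \<beta>) (1/2) \<subseteq> {x. \<beta> \<bullet> x \<le> t}"
          using slab[of _ "-1/2"] t by fastforce
        show "ball ((-1/2) *\<^sub>R \<beta>) (1/2) \<subseteq> ball 0 1" by (rule half[OF b1(1)]) simp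
      qed simp
      moreover have "measure ?Y {x. \<beta> \<bullet> x \<le> t} = 0"
      proof (rule measure_ball_pair_eq_0[OF dY meas])
        have far: "{x. \<beta> \<bullet> x \<le> t} \<inter> ball (s *\<^sub>R e) 1 = {}" if s: "4 \<le> s" for s
        proof -
          have "4 * (1/2) \<le> s * (\<beta> \<bullet> e)" using s be by (intro mult_mono) auto
          then show ?thesis
            using cs[OF b1(1), of _ "s *\<^sub>R e" 1] t by (fastforce simp: inner_diff_right abs_less_iff)
        qed
        show "{x. \<beta> \<bullet> x \<le> t} \<inter> ball (4 *\<^sub>R e) 1 = {}" by (rule far) simp
        show "{x. \<beta> \<bullet> x \<le> t} \<inter> ball ((R + 4) *\<^sub>R e) 1 = {}" using R by (intro far) simp
      qed
      ultimately show "(1/2) ^ DIM('a) / 2 \<le> proj_cdf ?X \<beta> t - proj_cdf ?Y \<beta> t"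
        by (simp add: proj_cdf_eq)
    }
    have strip: "{x. 0 < \<beta> \<bullet> x \<and> \<beta> \<bullet> x \<le> 1} \<in> sets borel" by measurable
    have "(1/2) ^ DIM('a) / 2 \<le> measure ?X {x. 0 < \<beta> \<bullet> x \<and> \<beta> \<bullet> x \<le> 1}"
    proof (rule measure_ball_pair_ge[OF dX strip])
      show "ball ((1/2) *\<^sub>R \<beta>) (1/2) \<subseteq> {x. 0 < \<beta> \<bullet> x \<and> \<beta> \<bullet> x \<le> 1}"
        using slab[of _ "1/2"] by fastforce
      show "ball ((1/2) *\<^sub>R \<beta>) (1/2) \<subseteq> ball 0 1" by (rule half[OF b1(1)]) simp
    qed simp
    also have "{x. 0 < \<beta> \<bullet> x \<and> \<beta> \<bullet> x \<le> 1} = {x. \<beta> \<bullet> x \<le> 1} - {x. \<beta> \<bullet> x \<le> 0}" by auto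
    also have "measure ?X \<dots> = measure ?X {x. \<beta> \<bullet> x \<le> 1} - measure ?X {x. \<beta> \<bullet> x \<le> 0}"
      by (rule X.finite_measure_Diff) (auto simp: meas)
    finally show "(1/2) ^ DIM('a) / 2 \<le> proj_cdf ?X \<beta> 1 - proj_cdf ?X \<beta> 0"
      by (simp add: proj_cdf_eq)
  qed (auto simp: X.prob_space_axioms Y.prob_space_axioms \<theta>)
qed

section \<open>From the energy test to the labels\<close>

lemma label_stat_gap:
  "\<exists>g>0. \<forall>A\<subseteq>{..<m + n}. \<forall>B\<subseteq>{..<m + n}.
     label_stat m n B < label_stat m n A \<longrightarrow> g \<le> label_stat m n A - label_stat m n B"
proof -
  let ?P = "Pow {..<m + n}"
  \<comment> \<open>Inserting 1 keeps the set nonempty when no two label values differ.\<close>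
  define D where "D = insert 1 ((\<lambda>(A, B). label_stat m n A - label_stat m n B) ` (?P \<times> ?P) \<inter> {0<..})"
  have D: "finite D" "D \<noteq> {}" by (auto simp: D_def)
  have "Min D \<in> D" using D by (rule Min_in)
  then have "0 < Min D" by (auto simp: D_def)
  moreover have "Min D \<le> label_stat m n A - label_stat m n B"
    if "A \<subseteq> {..<m + n}" "B \<subseteq> {..<m + n}" "label_stat m n B < label_stat m n A" for A B
    using that by (intro Min_le[OF D(1)]) (auto simp: D_def image_iff)
  ultimately show ?thesis by blast
qed

text \<open>Points within \<open>r\<close> of their label position have distances off by at most 2r,
  hence energy values off by at most 8r. Comparing two such values costs 16r, which is less than
  \<open>R\<close> times a label gap up to the boundary case. So a permutation that lowers the
  energy cannot raise the label statistic.\<close>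

lemma energy_reject_imp_label_reject:
  fixes z :: "nat \<Rightarrow> 'a::euclidean_space" and e :: 'a
  assumes mn: "2 \<le> m" "2 \<le> n" and \<alpha>: "\<alpha> \<in> {0<..<1}" and e: "norm e = 1" and R: "0 \<le> R"
    and B: "B \<subseteq> {..<m + n}"
    and near: "\<And>i. i < m + n \<Longrightarrow> norm (z i - (R * of_bool (i \<in> B)) *\<^sub>R e) \<le> r"
    and gap: "\<And>A. A \<subseteq> {..<m + n} \<Longrightarrow> label_stat m n B < label_stat m n A \<Longrightarrow> 16 * r \<le> R * (label_stat m n A - label_stat m n B)"
    and rej: "energy_test \<alpha> m n z = 1"
  shows "B \<in> label_reject \<alpha> m n"
proof -
  let ?P = "{p. p permutes {..<m + n}}"
  have finP: "finite ?P" by (simp add: finite_permutations)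
  define v where "v i = (of_bool (i \<in> B) :: real)" for i
  have approx: "\<bar>energy_stat m n (z \<circ> p) - R * label_stat m n (p -` B)\<bar> \<le> 4 * (2 * r)"
    if p: "p permutes {..<m + n}" for p
  proof -
    have "label_stat m n (p -` B) = energy_stat m n (v \<circ> p)"
      by (simp add: label_stat_def v_def o_def)
    moreover have "\<bar>energy_stat m n (z \<circ> p) - R * energy_stat m n (v \<circ> p)\<bar> \<le> 4 * (2 * r)"
    proof (rule energy_stat_perturb[OF mn])
      fix i j assume ij: "i < m + n" "j < m + n"
      define a where "a i = z i - (R * v i) *\<^sub>R e" for i
      have a: "norm (a (p i)) \<le> r" if "i < m + n" for i
        using near[of "p i"] permutes_in_image[OF p, of i] that by (simp add: a_def v_def)
      have "norm ((R * (v (p i) - v (p j))) *\<^sub>R e) = R * norm (v (p i) - v (p j))"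
        using R e by (simp add: abs_mult)
      moreover have "z (p i) - z (p j) = (R * (v (p i) - v (p j))) *\<^sub>R e + (a (p i) - a (p j))"
        by (simp add: a_def algebra_simps)
      ultimately have "\<bar>norm (z (p i) - z (p j)) - R * norm (v (p i) - v (p j))\<bar> \<le> norm (a (p i) - a (p j))"
        using norm_triangle_ineq3[of "z (p i) - z (p j)" "(R * (v (p i) - v (p j))) *\<^sub>R e"] by simp
      also have "\<dots> \<le> 2 * r"
        using norm_triangle_ineq4[of "a (p i)" "a (p j)"] a[OF ij(1)] a[OF ij(2)] by linarith
      finally show "\<bar>norm ((z \<circ> p) i - (z \<circ> p) j) - R * norm ((v \<circ> p) i - (v \<circ> p) j)\<bar> \<le> 2 * r" by simp
    qed
    ultimately show ?thesis by simp
  qed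
  have id: "\<bar>energy_stat m n z - R * label_stat m n B\<bar> \<le> 4 * (2 * r)"
    using approx[OF permutes_id] by simp
  have imp: "label_stat m n (p -` B) \<le> label_stat m n B"
    if p: "p permutes {..<m + n}" and less: "energy_stat m n (z \<circ> p) < energy_stat m n z" for p
  proof (rule ccontr)
    assume "\<not> ?thesis"
    then have "16 * r \<le> R * (label_stat m n (p -` B) - label_stat m n B)"
      using permutes_vimage_subset_card(1)[OF p B] by (intro gap) auto
    then have "16 * r \<le> R * label_stat m n (p -` B) - R * label_stat m n B"
      by (simp only: right_diff_distrib)
    then show False using approx[OF p] id less by linarith
  qed
  have "1 - \<alpha> \<le> 1 / fact (m + n) *
      (\<Sum>p\<in>?P. of_bool (energy_stat m n (z \<circ> p) < energy_stat m n z))"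
    using rej energy_test_reject_iff[OF \<alpha>] by blast
  also have "(\<Sum>p\<in>?P. of_bool (energy_stat m n (z \<circ> p) < energy_stat m n z))
      \<le> (\<Sum>p\<in>?P. of_bool (label_stat m n (p -` B) \<le> label_stat m n B) :: real)"
    using imp by (intro sum_mono) auto
  also have "\<dots> = real (card (?P \<inter> {p. label_stat m n (p -` B) \<le> label_stat m n B}))"
    using finP by (simp add: of_bool_def sum.If_cases)
  also have "?P \<inter> {p. label_stat m n (p -` B) \<le> label_stat m n B}
      = {p. p permutes {..<m + n} \<and> label_stat m n (p -` B) \<le> label_stat m n B}" by auto
  finally show ?thesis
    using B by (simp add: label_reject_def field_simps)
qed

lemma energy_power_ball_pair_le:
  fixes e :: "'a::euclidean_space"
  assumes mn: "2 \<le> m" "2 \<le> n" and \<alpha>: "\<alpha> \<in> {0<..<1}" and e: "norm e = 1" and R: "2 \<le> R"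
    and gap: "\<And>A B. A \<subseteq> {..<m + n} \<Longrightarrow> B \<subseteq> {..<m + n} \<Longrightarrow> label_stat m n B < label_stat m n A
      \<Longrightarrow> 80 \<le> R * (label_stat m n A - label_stat m n B)"
  shows "energy_power \<alpha> m n (ball_pair 0 (R *\<^sub>R e)) (ball_pair (4 *\<^sub>R e) ((R + 4) *\<^sub>R e))
    \<le> real (card (label_reject \<alpha> m n)) / 2 ^ (m + n)"
proof -
  let ?X = "ball_pair 0 (R *\<^sub>R e)" and ?Y = "ball_pair (4 *\<^sub>R e) ((R + 4) *\<^sub>R e)"
  let ?N = "m + n" and ?T = "two_sample m n ?X ?Y"
  have dX: "2 \<le> dist 0 (R *\<^sub>R e)" using e R by simp
  have dY: "2 \<le> dist (4 *\<^sub>R e) ((R + 4) *\<^sub>R e)"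
    using e R by (simp add: dist_norm flip: scaleR_diff_left)
  define M where "M i = (if i < m then ?X else ?Y)" for i :: nat
  define c where "c i b = (if i < m then 0 else 4 *\<^sub>R e) + (R * of_bool b) *\<^sub>R e" for i :: nat and b
  interpret finite_product_prob_space M "{..<?N}"
    by (simp add: finite_product_prob_space_def finite_product_sigma_finite_def
        finite_product_sigma_finite_axioms_def product_prob_space_def product_prob_space_axioms_def
        product_sigma_finite_def M_def prob_space_ball_pair[OF dX] prob_space_ball_pair[OF dY]
        prob_space_imp_sigma_finite)
  have T: "?T = PiM {..<?N} M" unfolding two_sample_def M_def ..
  interpret T: prob_space ?T unfolding T by (rule prob_space_axioms)
  have setsM: "sets (M i) = sets borel" for i by (simp add: M_def)
  \<comment> \<open>The mass is the same in both samples: this is what makes the labels exchangeable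
    although the distributions differ.\<close>
  have ball_half: "measure (M i) (ball (c i b) 1) = 1/2" for i b
    using measure_ball_pair_balls[OF dX] measure_ball_pair_balls[OF dY]
    by (simp add: M_def c_def algebra_simps)
  define box where "box B = (\<Pi>\<^sub>E i\<in>{..<?N}. ball (c i (i \<in> B)) 1)" for B
  have box_sets: "box B \<in> sets ?T" for B
    unfolding box_def T by (intro sets_PiM_I_finite) (auto simp: setsM)
  have box_prob: "measure ?T (box B) = (1/2) ^ ?N" for B
    unfolding box_def T by (subst prob_times) (auto simp: setsM ball_half)
  have box_disj: "disjoint_family_on box (Pow {..<?N})"
  proof (unfold disjoint_family_on_def, intro ballI impI)
    fix A B assume AB: "A \<in> Pow {..<?N}" "B \<in> Pow {..<?N}" "A \<noteq> B"
    then obtain i where i: "i < ?N" "(i \<in> A) \<noteq> (i \<in> B)" by blast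
    have "2 \<le> dist (c i (i \<in> A)) (c i (i \<in> B))"
      using e R i(2) by (auto simp: c_def dist_norm)
    then have "ball (c i (i \<in> A)) 1 \<inter> ball (c i (i \<in> B)) 1 = {}" by (rule disjoint_unit_balls)
    then show "box A \<inter> box B = {}"
      using i(1) by (auto simp: box_def PiE_iff)
  qed
  define Rej where "Rej = {z \<in> space ?T. energy_test \<alpha> m n z = 1}"
  \<comment> \<open>The estimate goes through the complement: rejection misses every box indexed by
    \<open>W\<close>, so its probability is at most one minus their total mass.\<close>
  define W where "W = Pow {..<?N} - label_reject \<alpha> m n"
  have finW: "finite W" by (simp add: W_def)
  have Rej_sets: "Rej \<in> sets ?T"
    unfolding Rej_def by (rule energy_test_reject_sets[OF \<alpha>]) auto
  have "Rej \<inter> box B = {}" if "B \<in> W" for B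
  proof (rule ccontr)
    assume "Rej \<inter> box B \<noteq> {}"
    then obtain z where z: "energy_test \<alpha> m n z = 1" "z \<in> box B" by (auto simp: Rej_def)
    have "B \<in> label_reject \<alpha> m n"
    proof (rule energy_reject_imp_label_reject[OF mn \<alpha> e _ _ _ _ z(1)])
      \<comment> \<open>The radius is 5 = 1 + 4, from the unit ball and the shift of the second
        sample; hence 80 = 16 * 5 in the gap hypothesis.\<close>
      show "norm (z i - (R * of_bool (i \<in> B)) *\<^sub>R e) \<le> 5" if "i < ?N" for i
      proof -
        define a where "a = (if i < m then 0 else 4 *\<^sub>R e)"
        have 1: "norm (z i - c i (i \<in> B)) < 1"
          using z(2) that by (auto simp: box_def PiE_iff dist_norm norm_minus_commute)
        have 2: "norm a \<le> 4" using e by (simp add: a_def)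
        have 3: "z i - (R * of_bool (i \<in> B)) *\<^sub>R e = (z i - c i (i \<in> B)) + a"
          by (simp add: c_def a_def)
        show ?thesis
          unfolding 3 using norm_triangle_ineq[of "z i - c i (i \<in> B)" a] 1 2 by linarith
      qed
      show "16 * 5 \<le> R * (label_stat m n A - label_stat m n B)"
        if "A \<subseteq> {..<?N}" "label_stat m n B < label_stat m n A" for A
        using gap[OF that(1) _ that(2)] \<open>B \<in> W\<close> by (simp add: W_def)
    qed (use R \<open>B \<in> W\<close> in \<open>auto simp: W_def\<close>)
    with that show False by (simp add: W_def)
  qed
  then have disj: "Rej \<inter> (\<Union>B\<in>W. box B) = {}" by blast
  have "measure ?T (\<Union>B\<in>W. box B) = (\<Sum>B\<in>W. measure ?T (box B))"
    using finW box_sets disjoint_family_on_mono[OF _ box_disj, of W]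
    by (intro T.finite_measure_finite_Union) (auto simp: W_def)
  also have "\<dots> = real (card W) / 2 ^ ?N" by (simp add: box_prob power_divide)
  also have "real (card W) = 2 ^ ?N - real (card (label_reject \<alpha> m n))"
  proof -
    have sub: "label_reject \<alpha> m n \<subseteq> Pow {..<?N}" by (auto simp: label_reject_def)
    then have "card W = card (Pow {..<?N}) - card (label_reject \<alpha> m n)"
      unfolding W_def by (intro card_Diff_subset) (auto intro: finite_subset)
    moreover have "card (label_reject \<alpha> m n) \<le> card (Pow {..<?N})" by (intro card_mono sub) auto
    ultimately show ?thesis by (simp add: card_Pow of_nat_diff)
  qed
  finally have W: "measure ?T (\<Union>B\<in>W. box B) = 1 - real (card (label_reject \<alpha> m n)) / 2 ^ ?N"
    by (simp add: diff_divide_distrib)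
  have "measure ?T Rej + measure ?T (\<Union>B\<in>W. box B) = measure ?T (Rej \<union> (\<Union>B\<in>W. box B))"
    using Rej_sets box_sets finW disj by (intro T.finite_measure_Union[symmetric]) auto
  also have "\<dots> \<le> 1" by (rule T.prob_le_1)
  finally show ?thesis unfolding energy_power_def Rej_def[symmetric] W by simp
qed

theorem proposition4p2:
  fixes \<alpha> \<theta> :: real
  assumes "0 < \<alpha>" "\<alpha> < 1" and "0 < \<theta>" "\<theta> < 1"
  shows "\<exists>c0>0. \<forall>c\<ge>c0.
    Limsup (sequentially \<times>\<^sub>F sequentially)
      (\<lambda>(m, n). INF (PX, PY) \<in> (cvm_class \<theta> (c * (real m powr (-1/2) + real n powr (-1/2)))
            :: ((real ^ 'd) measure \<times> (real ^ 'd) measure) set).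
          ereal (energy_power \<alpha> m n PX PY))
    \<le> ereal \<alpha>"
proof (intro exI[of _ 1] conjI allI impI)
  fix c :: real assume c: "1 \<le> c"
  let ?class = "\<lambda>m n. cvm_class \<theta> (c * (real m powr (-1/2) + real n powr (-1/2)))
    :: ((real ^ 'd) measure \<times> (real ^ 'd) measure) set"
  obtain e :: "real ^ 'd" where e: "norm e = 1" using vector_choose_size[of 1] by auto
  \<comment> \<open>\<open>w\<close> bounds the CvM distance of the pair from below for every
    admissible \<open>R\<close>, whereas the radius of the class tends to 0 for fixed
    \<open>c\<close>. The threshold for \<open>c\<close> is therefore arbitrary, and 1
    serves.\<close>
  define w where "w = sqrt (\<theta> * ((1/2) ^ DIM(real ^ 'd) / 2) ^ 3 * measure uniform_sphere (spherical_cap e))"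
  have w: "0 < w" using assms measure_spherical_cap_pos[OF e] by (simp add: w_def)
  have "((\<lambda>k. real k powr (-1/2)) \<longlongrightarrow> 0) sequentially"
    by (intro tendsto_neg_powr filterlim_real_sequentially) simp
  then have "\<forall>\<^sub>F k in sequentially. real k powr (-1/2) < w / (2 * c)"
    using w c by (intro order_tendstoD(2)) auto
  then obtain N1 where N1: "\<And>k. N1 \<le> k \<Longrightarrow> real k powr (-1/2) < w / (2 * c)"
    by (auto simp: eventually_sequentially)
  show "Limsup (sequentially \<times>\<^sub>F sequentially)
      (\<lambda>(m, n). INF (PX, PY) \<in> ?class m n. ereal (energy_power \<alpha> m n PX PY)) \<le> ereal \<alpha>"
  proof (rule ereal_le_epsilon2)
    fix \<delta> :: real assume "0 < \<delta>"
    then obtain N0 where N0: "\<And>m n. N0 \<le> m \<Longrightarrow> N0 \<le> n \<Longrightarrow>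
        real (card (label_reject \<alpha> m n)) / 2 ^ (m + n) \<le> \<alpha> + \<delta>"
      using card_label_reject_eventually[of \<alpha> \<delta>] assms by auto
    have "(INF (PX, PY) \<in> ?class m n. ereal (energy_power \<alpha> m n PX PY)) \<le> ereal \<alpha> + ereal \<delta>"
      if mn: "max 2 (max N0 N1) \<le> m" "max 2 (max N0 N1) \<le> n" for m n
    proof -
      obtain g where g: "0 < g" "\<And>A B. A \<subseteq> {..<m + n} \<Longrightarrow> B \<subseteq> {..<m + n} \<Longrightarrow>
          label_stat m n B < label_stat m n A \<Longrightarrow> g \<le> label_stat m n A - label_stat m n B"
        using label_stat_gap by metis
      \<comment> \<open>The 2 keeps the balls of each pair disjoint; 80/g lets the smallest label
        gap for these m and n outweigh the approximation error.\<close>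
      define R where "R = max 2 (80 / g)"
      let ?X = "ball_pair 0 (R *\<^sub>R e)" and ?Y = "ball_pair (4 *\<^sub>R e) ((R + 4) *\<^sub>R e)"
      have R: "2 \<le> R" "80 \<le> R * g" using g(1) by (auto simp: R_def max_def field_simps)
      have "c * (real m powr (-1/2) + real n powr (-1/2)) \<le> c * (w / (2 * c) + w / (2 * c))"
        using N1[of m] N1[of n] mn c by (intro mult_left_mono) auto
      also have "\<dots> = w" using c by simp
      also have "w \<le> cvm_dist \<theta> ?X ?Y"
        unfolding w_def using assms R by (intro cvm_dist_ball_pair_ge e) auto
      finally have "(?X, ?Y) \<in> ?class m n"
        using e R by (simp add: cvm_class_def admissible_ball_pair dist_norm flip: scaleR_diff_left)
      moreover have "energy_power \<alpha> m n ?X ?Y \<le> \<alpha> + \<delta>"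
      proof (rule order_trans[OF energy_power_ball_pair_le N0])
        show "80 \<le> R * (label_stat m n A - label_stat m n B)"
          if "A \<subseteq> {..<m + n}" "B \<subseteq> {..<m + n}" "label_stat m n B < label_stat m n A" for A B
          using g(2)[OF that] R mult_left_mono[of g "label_stat m n A - label_stat m n B" R] by linarith
      qed (use mn e R assms in auto)
      ultimately show ?thesis
        by (intro INF_lower2[of "(?X, ?Y)"]) auto
    qed
    then have "\<forall>\<^sub>F x in sequentially \<times>\<^sub>F sequentially.
        (case x of (m, n) \<Rightarrow> INF (PX, PY) \<in> ?class m n. ereal (energy_power \<alpha> m n PX PY)) \<le> ereal \<alpha> + ereal \<delta>"
      unfolding eventually_prod_sequentially by (intro exI[of _ "max 2 (max N0 N1)"]) simp
    then show "Limsup (sequentially \<times>\<^sub>F sequentially)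
        (\<lambda>(m, n). INF (PX, PY) \<in> ?class m n. ereal (energy_power \<alpha> m n PX PY)) \<le> ereal \<alpha> + ereal \<delta>"
      by (rule Limsup_bounded)
  qed
qed simp

end
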